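(* Let \( 1\leq p <\infty \). Then, under CH, the following isometric isomorphism holds: $L^{p}(\mu)\cong \ell^{p}(\mathfrak{c},L^{p}[0,1])$.
   Context: Let $\mathcal{B}$ be the Borel $\sigma$-algebra of $\mathbb{R}$, $\lambda$ the Lebesgue measure on $(\mathbb{R},\mathcal{B})$, and $\mathcal{B}_{\infty}$ the $\sigma$-algebra on $\mathbb{R}^{\mathbb{N}}$ generated by the cylinder sets $\prod_{i=1}^{m}C_{i}\times\prod_{i=m+1}^{\infty}\mathbb{R}$ with $C_i\in\mathcal{B}$, $m\in\mathbb{N}$ (it coincides with the Borel $\sigma$-algebra of the product topology). Let $\mathcal{F}(\mathcal{B},\lambda)$ be the set of finite rectangles $\prod_{i\in\mathbb{N}}C_{i}$ with $C_i\in\mathcal{B}$ and $\prod_{i\in\mathbb{N}}\lambda(C_i)\in[0,\infty)$, with $\mathrm{vol}(\prod_{i}C_i):=\prod_i\lambda(C_i)$. The measure $\mu$ is the restriction to $\mathcal{B}_{\infty}$ of the outer measure $\mu^{\ast}(A):=\inf\{\sum_{n}\mathrm{vol}(\mathscr{C}_{n}) : \mathscr{C}_{n}\in\mathcal{F}(\mathcal{B},\lambda),\ A\subset\bigcup_{n}\mathscr{C}_{n}\}$ (with $\inf\varnothing=\infty$). For a set $J$ and a Banach space $X$, $\ell^{p}(J,X)$ is the space of families $(x_j)_{j\in J}$ in $X$ with $\sum_{j}\|x_j\|^{p}<\infty$, normed by $(\sum_j\|x_j\|^p)^{1/p}$; $\mathfrak{c}$ is the cardinality of the continuum and CH is the continuum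 hypothesis. *)

theory Defs
  imports "HOL-Analysis.Analysis"
begin

definition cylinders :: "(nat \<Rightarrow> real) set set" where
  "cylinders = {{x. \<forall>i<m. x i \<in> C i} | m C. \<forall>i<m. C i \<in> sets borel}"

definition B_inf :: "(nat \<Rightarrow> real) set set" where
  "B_inf = sigma_sets UNIV cylinders"

definition rect :: "(nat \<Rightarrow> real set) \<Rightarrow> (nat \<Rightarrow> real) set" where
  "rect D = {x. \<forall>i. x i \<in> D i}"

definition partial_vol :: "(nat \<Rightarrow> real set) \<Rightarrow> nat \<Rightarrow> ennreal" where
  "partial_vol D n = (\<Prod>i<n. emeasure lborel (D i))"

definition finite_rect :: "(nat \<Rightarrow> real set) \<Rightarrow> bool" where
  "finite_rect D \<longleftrightarrow> (\<forall>i. D i \<in> sets borel) \<and>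
     (\<exists>v. v < \<infinity> \<and> partial_vol D \<longlonglongrightarrow> v)"

definition vol :: "(nat \<Rightarrow> real set) \<Rightarrow> ennreal" where
  "vol D = lim (partial_vol D)"

definition mu_outer :: "(nat \<Rightarrow> real) set \<Rightarrow> ennreal" where
  "mu_outer A = Inf {(\<Sum>n. vol (C n)) | C. (\<forall>n. finite_rect (C n)) \<and> A \<subseteq> (\<Union>n. rect (C n))}"

definition mu :: "(nat \<Rightarrow> real) measure" where
  "mu = measure_of UNIV cylinders mu_outer"

section \<open>L^p spaces (as sets of representatives with the L^p seminorm)\<close>

definition Lp_set :: "real \<Rightarrow> 'a measure \<Rightarrow> ('a \<Rightarrow> real) set" where
  "Lp_set p M = {f \<in> borel_measurable M. integrable M (\<lambda>x. \<bar>f x\<bar> powr p)}"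

definition Lp_norm :: "real \<Rightarrow> 'a measure \<Rightarrow> ('a \<Rightarrow> real) \<Rightarrow> real" where
  "Lp_norm p M f = (\<integral>x. \<bar>f x\<bar> powr p \<partial>M) powr (1 / p)"

abbreviation L01 :: "real measure" where
  "L01 \<equiv> lebesgue_on {0..1}"

text \<open>ell^p(c, L^p[0,1]), the index set of cardinality continuum being the reals.\<close>
definition ellp_Lp01 :: "real \<Rightarrow> (real \<Rightarrow> real \<Rightarrow> real) set" where
  "ellp_Lp01 p = {g. (\<forall>j. g j \<in> Lp_set p L01) \<and>
                     (\<lambda>j. Lp_norm p L01 (g j) powr p) summable_on UNIV}"

definition ellp_norm :: "real \<Rightarrow> (real \<Rightarrow> real \<Rightarrow> real) \<Rightarrow> real" where
  "ellp_norm p g = (\<Sum>\<^sub>\<infinity>j. Lp_norm p L01 (g j) powr p) powr (1 / p)"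

definition CH :: bool where
  "CH \<longleftrightarrow> (\<forall>A :: real set. countable A \<or> (\<exists>f. bij_betw f A (UNIV :: real set)))"

end

theory Submission
  imports Defs "HOL-Probability.Infinite_Product_Measure" "HOL-Probability.Weak_Convergence"
begin

text \<open>
  One-coordinate cylinders split finite rectangles additively, so Caratheodory's theorem makes \<open>mu\<close> a
  measure. By outer regularity every set of finite measure is, up to a null set, covered by
  countably many finite rectangles with open sides, and there are only continuum many of these.
  Under CH they can be well-ordered with countable initial segments; subtracting from each
  rectangle its predecessors gives disjoint Borel pieces of finite measure, countably many of which
  cover any given set of finite measure up to a null set. Uncountably many, hence (CH again)
  continuum many, pieces have positive measure, because the unit cubes
  \<open>\<Prod>[s, s + 1]\<close> for real \<open>s\<close> are pairwise almost disjoint. Each piece is atomless, hence isomorphic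
  modulo null sets to a rescaled unit interval, and \<open>L\<^sup>p(mu)\<close> is the \<open>\<ell>\<^sup>p\<close>-sum over the pieces.
\<close>

section \<open>The outer measure and its restriction\<close>

text \<open>The obstacle is that \<open>mu\<close> is not sigma-finite. Unit cubes offset by e with
  0 < e <= 1 meet in a cube of side 1 - e, whose volume is the limit of (1 - e)^n, hence 0; so
  uncountably many almost disjoint sets have measure at least 1. No countable exhaustion exists, and
  subtracting an uncountable union of predecessors could leave the sigma-algebra. A single function
  in L^p, however, lives on a set that is a countable union of sets of finite measure, so it sees
  only countably many pieces, and all integrals reduce to countable sums. The comparison of a piece
  with the unit interval is a point map \<open>\<theta>\<close> from [0,1] with a left inverse
  \<open>\<Phi>\<close> valid almost everywhere: composing with \<open>\<theta>\<close> carries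
  functions to the interval isometrically up to a factor, and composing with \<open>\<Phi>\<close>
  brings them back.\<close>

lemma finite_rectD: "finite_rect D \<Longrightarrow> D i \<in> sets borel"
  by (simp add: finite_rect_def)

lemma partial_vol_tendsto_vol:
  assumes "finite_rect D"
  shows "partial_vol D \<longlonglongrightarrow> vol D" and "vol D < \<infinity>"
proof -
  from assms obtain v where "v < \<infinity>" "partial_vol D \<longlonglongrightarrow> v"
    by (auto simp: finite_rect_def)
  moreover from this have "vol D = v"
    by (simp add: vol_def limI)
  ultimately show "partial_vol D \<longlonglongrightarrow> vol D" "vol D < \<infinity>" by auto
qed

lemma finite_rectI:
  assumes "\<And>i. D i \<in> sets borel" "partial_vol D \<longlonglongrightarrow> v" "v < \<infinity>"
  shows "finite_rect D" and "vol D = v"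
  using assms by (auto simp: finite_rect_def vol_def intro: limI)

lemma finite_rect_eventually_zeroI:
  assumes "\<And>i. D i \<in> sets borel" "eventually (\<lambda>n. partial_vol D n = 0) sequentially"
  shows "finite_rect D" and "vol D = 0"
proof -
  have "partial_vol D \<longlonglongrightarrow> 0"
    using assms(2) by (simp add: tendsto_eventually)
  with assms(1) show "finite_rect D" "vol D = 0"
    using finite_rectI by auto
qed

lemma partial_vol_remove:
  "i < n \<Longrightarrow> partial_vol (D(i := E)) n = emeasure lborel E * (\<Prod>k\<in>{..<n} - {i}. emeasure lborel (D k))"
  unfolding partial_vol_def by (subst prod.remove[of _ i]) auto

text \<open>For a side of positive finite measure, \<open>c\<close> is the ratio of the new measure
  to the old one. Sides of measure 0 or \<open>\<infinity>\<close> are treated apart, and both lead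
  to c = 0.\<close>

lemma partial_vol_update_le:
  assumes "finite_rect D" "emeasure lborel E \<le> emeasure lborel (D i)"
  obtains c where "c \<le> 1" "eventually (\<lambda>n. partial_vol (D(i := E)) n = c * partial_vol D n) sequentially"
proof -
  define Q where "Q n = (\<Prod>k\<in>{..<n} - {i}. emeasure lborel (D k))" for n
  have E: "partial_vol (D(i := E)) n = emeasure lborel E * Q n" if "i < n" for n
    using that by (simp add: partial_vol_remove Q_def)
  have D: "partial_vol D n = emeasure lborel (D i) * Q n" if "i < n" for n
    using partial_vol_remove[OF that, of D "D i"] by (simp add: Q_def)
  have ev: "eventually (\<lambda>n. i < n) sequentially"
    by (rule eventually_gt_at_top)
  consider "emeasure lborel (D i) = 0" | "emeasure lborel (D i) = \<infinity>"
    | "emeasure lborel (D i) \<noteq> 0" "emeasure lborel (D i) \<noteq> \<infinity>" by blast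
  then show ?thesis
  proof cases
    case 1
    with assms have "emeasure lborel E = 0" by simp
    then show ?thesis by (intro that[of 0] eventually_mono[OF ev]) (auto simp: E)
  next
    case 2
    \<comment> \<open>A finite limit makes the partial volumes eventually finite, and an infinite
      factor allows that only if the remaining factors multiply to 0.\<close>
    have "eventually (\<lambda>n. partial_vol D n < \<infinity>) sequentially"
      using partial_vol_tendsto_vol[OF assms(1)] by (rule order_tendstoD)
    with ev have "eventually (\<lambda>n. Q n = 0 \<and> i < n) sequentially"
    proof eventually_elim
      case (elim n)
      with 2 D[of n] show ?case by (auto simp: ennreal_top_mult split: if_splits)
    qed
    then show ?thesis by (intro that[of 0]) (auto elim!: eventually_mono simp: E)
  next
    case 3
    show ?thesis
    proof (rule that)
      show "emeasure lborel E / emeasure lborel (D i) \<le> 1"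
        using 3 assms(2) by (metis divide_right_mono_ennreal ennreal_divide_self infinity_ennreal_def less_top)
      have "emeasure lborel E = emeasure lborel E / emeasure lborel (D i) * emeasure lborel (D i)"
        using 3 by (metis ennreal_divide_times ennreal_divide_self infinity_ennreal_def less_top mult_1_right ennreal_times_divide)
      then show "eventually (\<lambda>n. partial_vol (D(i := E)) n = emeasure lborel E / emeasure lborel (D i) * partial_vol D n) sequentially"
        by (intro eventually_mono[OF ev]) (simp add: E D mult.assoc[symmetric])
    qed
  qed
qed

lemma finite_rect_update:
  assumes "finite_rect D" "E \<in> sets borel" "emeasure lborel E \<le> emeasure lborel (D i)"
  shows "finite_rect (D(i := E))"
proof -
  obtain c where c: "c \<le> 1" "eventually (\<lambda>n. partial_vol (D(i := E)) n = c * partial_vol D n) sequentially"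
    using partial_vol_update_le assms by blast
  \<comment> \<open>Finiteness makes multiplication by \<open>c\<close> continuous on
    \<open>ennreal\<close>, also at 0.\<close>
  have "c < \<infinity>"
    using c(1) by (metis ennreal_one_less_top infinity_ennreal_def order_le_less_trans)
  then have "(\<lambda>n. c * partial_vol D n) \<longlonglongrightarrow> c * vol D"
    using partial_vol_tendsto_vol[OF assms(1)] by (intro ennreal_tendsto_cmult) auto
  then have "partial_vol (D(i := E)) \<longlonglongrightarrow> c * vol D"
    using c(2) by (subst tendsto_cong) auto
  moreover have "c * vol D < \<infinity>"
    using \<open>c < \<infinity>\<close> partial_vol_tendsto_vol(2)[OF assms(1)] by (simp add: ennreal_mult_less_top)
  ultimately show ?thesis
    using assms finite_rectD by (intro finite_rectI) auto
qed

text \<open>Once n exceeds i, the partial volumes of the two halves differ in one factor only, so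
  additivity of \<open>lborel\<close> on that side passes to the limit. This feeds Caratheodory's
  criterion for coordinate sets.\<close>

lemma vol_split:
  assumes "finite_rect D" "B \<in> sets borel"
  shows "vol (D(i := D i \<inter> B)) + vol (D(i := D i - B)) = vol D"
proof (rule LIMSEQ_unique)
  have [measurable]: "D i \<in> sets borel" "B \<in> sets borel" using assms finite_rectD by auto
  have f: "finite_rect (D(i := D i \<inter> B))" "finite_rect (D(i := D i - B))"
    using assms by (auto intro!: finite_rect_update emeasure_mono)
  show "(\<lambda>n. partial_vol (D(i := D i \<inter> B)) n + partial_vol (D(i := D i - B)) n) \<longlonglongrightarrow>
      vol (D(i := D i \<inter> B)) + vol (D(i := D i - B))"
    using f by (intro tendsto_add partial_vol_tendsto_vol)
  have "emeasure lborel (D i \<inter> B) + emeasure lborel (D i - B) = emeasure lborel (D i)"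
    by (subst plus_emeasure) (auto simp: Int_Diff_Un)
  then have "partial_vol (D(i := D i \<inter> B)) n + partial_vol (D(i := D i - B)) n = partial_vol D n" if "i < n" for n
    using partial_vol_remove[OF that, of D "D i"]
    by (simp add: partial_vol_remove[OF that] distrib_right[symmetric] del: fun_upd_apply)
  then have "eventually (\<lambda>n. partial_vol (D(i := D i \<inter> B)) n + partial_vol (D(i := D i - B)) n = partial_vol D n) sequentially"
    by (auto intro: eventually_mono[OF eventually_gt_at_top[of i]])
  then show "(\<lambda>n. partial_vol (D(i := D i \<inter> B)) n + partial_vol (D(i := D i - B)) n) \<longlonglongrightarrow> vol D"
    using partial_vol_tendsto_vol[OF assms(1)] by (subst tendsto_cong) auto
qed

section \<open>The outer measure and Caratheodory's criterion\<close>

lemma mu_outer_le: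
  "(\<And>n. finite_rect (C n)) \<Longrightarrow> A \<subseteq> (\<Union>n. rect (C n)) \<Longrightarrow> mu_outer A \<le> (\<Sum>n. vol (C n))"
  unfolding mu_outer_def by (rule Inf_lower) auto

lemma mu_outer_greatest:
  assumes "\<And>C. (\<And>n. finite_rect (C n)) \<Longrightarrow> A \<subseteq> (\<Union>n. rect (C n)) \<Longrightarrow> v \<le> (\<Sum>n. vol (C n))"
  shows "v \<le> mu_outer A"
  unfolding mu_outer_def by (rule Inf_greatest) (use assms in auto)

lemma finite_rect_empty: "finite_rect (\<lambda>_. {})" "vol (\<lambda>_. {}) = 0"
proof -
  \<comment> \<open>The empty product at n = 0 is 1, so the partial volumes vanish only from n = 1
    on.\<close>
  have "eventually (\<lambda>n. partial_vol (\<lambda>_. {}) n = 0) sequentially"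
    by (rule eventually_mono[OF eventually_gt_at_top[of 0]]) (simp add: partial_vol_def power_0_left)
  then show "finite_rect (\<lambda>_. {})" "vol (\<lambda>_. {}) = 0"
    using finite_rect_eventually_zeroI[of "\<lambda>_. {}"] by auto
qed

lemma mu_outer_rect_le:
  assumes "finite_rect D" shows "mu_outer (rect D) \<le> vol D"
proof -
  let ?C = "\<lambda>n::nat. if n = 0 then D else (\<lambda>_. {})"
  have "mu_outer (rect D) \<le> (\<Sum>n. vol (?C n))"
    by (intro mu_outer_le) (auto simp: assms finite_rect_empty split: if_splits)
  also have "\<dots> = vol D"
    by (subst suminf_finite[of "{0}"]) (auto simp: finite_rect_empty)
  finally show ?thesis .
qed

lemma mu_outer_mono: "A \<subseteq> B \<Longrightarrow> mu_outer A \<le> mu_outer B"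
  by (rule mu_outer_greatest) (auto intro!: mu_outer_le)

lemma mu_outer_cover:
  assumes "mu_outer A < v"
  obtains C where "\<And>n. finite_rect (C n)" "A \<subseteq> (\<Union>n. rect (C n))" "(\<Sum>n. vol (C n)) < v"
  using assms unfolding mu_outer_def Inf_less_iff by auto

lemma mu_outer_UN_le: "mu_outer (\<Union>n. A n) \<le> (\<Sum>n. mu_outer (A n))"
proof (rule ennreal_le_epsilon)
  fix e :: real assume "0 < e" and fin: "(\<Sum>n. mu_outer (A n)) < top"
  have "\<exists>C. (\<forall>m. finite_rect (C m)) \<and> A n \<subseteq> (\<Union>m. rect (C m)) \<and>
      (\<Sum>m. vol (C m)) \<le> mu_outer (A n) + ennreal (e * (1/2) ^ Suc n)" for n
  proof -
    have "mu_outer (A n) \<noteq> top"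
      using fin by (metis ennreal_suminf_lessD less_irrefl)
    moreover have "0 < ennreal (e * (1/2) ^ Suc n)" using \<open>0 < e\<close> by (simp del: power_Suc)
    ultimately have "mu_outer (A n) < mu_outer (A n) + ennreal (e * (1/2) ^ Suc n)"
      by (simp add: less_top[symmetric] ennreal_add_left_cancel_less del: power_Suc)
    then show ?thesis by (elim mu_outer_cover) (auto intro!: less_imp_le)
  qed
  then obtain C where C: "\<And>n m. finite_rect (C n m)" "\<And>n. A n \<subseteq> (\<Union>m. rect (C n m))"
      "\<And>n. (\<Sum>m. vol (C n m)) \<le> mu_outer (A n) + ennreal (e * (1/2) ^ Suc n)" by metis
  have "mu_outer (\<Union>n. A n) \<le> (\<Sum>k. vol (case_prod C (prod_decode k)))"
  proof (rule mu_outer_le)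
    show "finite_rect (case_prod C (prod_decode k))" for k by (auto simp: C split: prod.split)
    show "(\<Union>n. A n) \<subseteq> (\<Union>k. rect (case_prod C (prod_decode k)))"
    proof
      fix x assume "x \<in> (\<Union>n. A n)"
      then obtain n m where "x \<in> rect (C n m)" using C(2) by blast
      then have "x \<in> rect (case_prod C (prod_decode (prod_encode (n, m))))" by simp
      then show "x \<in> (\<Union>k. rect (case_prod C (prod_decode k)))" by blast
    qed
  qed
  also have "\<dots> = (\<Sum>n. \<Sum>m. vol (C n m))"
    using suminf_ennreal_2dimen[of "\<lambda>n. \<Sum>m. vol (C n m)" "\<lambda>p. vol (case_prod C p)"]
    by (simp add: o_def)
  also have "\<dots> \<le> (\<Sum>n. mu_outer (A n) + ennreal (e * (1/2) ^ Suc n))"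
    by (intro suminf_le C) auto
  also have "\<dots> = (\<Sum>n. mu_outer (A n)) + (\<Sum>n. ennreal (e * (1/2) ^ Suc n))"
    by (intro suminf_add[symmetric]) auto
  also have "(\<Sum>n. ennreal (e * (1/2) ^ Suc n)) = ennreal e"
    using sums_mult[OF power_half_series, of e] \<open>0 < e\<close>
    by (subst suminf_ennreal_eq) auto
  finally show "mu_outer (\<Union>n. A n) \<le> (\<Sum>n. mu_outer (A n)) + ennreal e" .
qed

lemma mu_outer_empty: "mu_outer {} = 0"
proof -
  have "mu_outer {} \<le> (\<Sum>n::nat. vol (\<lambda>_. {}))"
    by (rule mu_outer_le) (auto simp: finite_rect_empty)
  then show ?thesis by (simp add: finite_rect_empty)
qed

lemma outer_measure_space_mu_outer: "outer_measure_space (Pow UNIV) mu_outer"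
  unfolding outer_measure_space_def positive_def increasing_def countably_subadditive_def
  by (auto simp: mu_outer_empty mu_outer_UN_le intro!: mu_outer_mono)

lemma mu_outer_le_Int_Diff: "mu_outer A \<le> mu_outer (A \<inter> S) + mu_outer (A - S)"
proof -
  interpret algebra UNIV "Pow (UNIV :: (nat \<Rightarrow> real) set)" by (rule algebra_Pow)
  have "subadditive (Pow UNIV) mu_outer"
    using outer_measure_space_mu_outer
    by (intro countably_subadditive_subadditive) (auto simp: outer_measure_space_def)
  then have "mu_outer ((A \<inter> S) \<union> (A - S)) \<le> mu_outer (A \<inter> S) + mu_outer (A - S)"
    by (rule subadditiveD) auto
  then show ?thesis by (simp add: Int_Diff_Un)
qed

text \<open>Cutting every rectangle of a cover of \<open>A\<close> along coordinate \<open>i\<close>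
  yields covers of the two parts of \<open>A\<close>, and \<open>vol_split\<close> keeps the total
  volume unchanged.\<close>

lemma coordinate_in_lambda_system:
  assumes B: "B \<in> sets borel"
  shows "{x. x i \<in> B} \<in> lambda_system UNIV (Pow UNIV) mu_outer"
proof -
  have "mu_outer (A \<inter> {x. x i \<in> B}) + mu_outer (A - {x. x i \<in> B}) = mu_outer A" for A
  proof (rule antisym)
    show "mu_outer (A \<inter> {x. x i \<in> B}) + mu_outer (A - {x. x i \<in> B}) \<le> mu_outer A"
    proof (rule mu_outer_greatest)
      fix C assume C: "\<And>n::nat. finite_rect (C n)" "A \<subseteq> (\<Union>n. rect (C n))"
      let ?I = "\<lambda>n. (C n)(i := C n i \<inter> B)" and ?D = "\<lambda>n. (C n)(i := C n i - B)"
      have f: "finite_rect (?I n)" "finite_rect (?D n)" for n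
        using C(1)[of n] B finite_rectD[OF C(1)] by (auto intro!: finite_rect_update emeasure_mono)
      have "mu_outer (A \<inter> {x. x i \<in> B}) \<le> (\<Sum>n. vol (?I n))"
        using C(2) by (intro mu_outer_le f) (force simp: rect_def)
      moreover have "mu_outer (A - {x. x i \<in> B}) \<le> (\<Sum>n. vol (?D n))"
      proof (intro mu_outer_le f)
        show "A - {x. x i \<in> B} \<subseteq> (\<Union>n. rect (?D n))"
        proof
          fix x assume x: "x \<in> A - {x. x i \<in> B}"
          with C(2) obtain n where "x \<in> rect (C n)" by auto
          with x have "x \<in> rect (?D n)" by (auto simp: rect_def)
          then show "x \<in> (\<Union>n. rect (?D n))" by blast
        qed
      qed
      ultimately have "mu_outer (A \<inter> {x. x i \<in> B}) + mu_outer (A - {x. x i \<in> B}) \<le> (\<Sum>n. vol (?I n)) + (\<Sum>n. vol (?D n))"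
        by (rule add_mono)
      also have "\<dots> = (\<Sum>n. vol (?I n) + vol (?D n))"
        by (intro suminf_add) auto
      also have "\<dots> = (\<Sum>n. vol (C n))"
        using vol_split[OF C(1) B] by simp
      finally show "mu_outer (A \<inter> {x. x i \<in> B}) + mu_outer (A - {x. x i \<in> B}) \<le> (\<Sum>n. vol (C n))" .
    qed
    show "mu_outer A \<le> mu_outer (A \<inter> {x. x i \<in> B}) + mu_outer (A - {x. x i \<in> B})"
      by (rule mu_outer_le_Int_Diff)
  qed
  then show ?thesis
    by (subst algebra.lambda_system_eq[OF algebra_Pow]) auto
qed

lemma measure_space_mu_outer: "measure_space UNIV (sigma_sets UNIV cylinders) mu_outer"
proof -
  let ?L = "lambda_system UNIV (Pow UNIV) mu_outer"
  have L: "measure_space UNIV ?L mu_outer"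
    by (rule sigma_algebra.caratheodory_lemma[OF sigma_algebra_Pow outer_measure_space_mu_outer])
  then interpret L: sigma_algebra UNIV ?L
    by (simp add: measure_space_def)
  have "cylinders \<subseteq> ?L"
  proof
    fix A assume "A \<in> cylinders"
    then obtain m C where A: "A = {x. \<forall>i<m. x i \<in> C i}" and C: "\<forall>i<m. C i \<in> sets borel"
      by (auto simp: cylinders_def)
    \<comment> \<open>\<open>finite_INT\<close> excludes the empty intersection; the cylinder with m
      = 0 is the whole space.\<close>
    have "(\<Inter>i\<in>{..<m}. {x. x i \<in> C i}) \<in> ?L" if "m \<noteq> 0"
      using that C by (intro L.finite_INT coordinate_in_lambda_system) auto
    moreover have "A = (\<Inter>i\<in>{..<m}. {x. x i \<in> C i})" by (auto simp: A)
    moreover have "UNIV \<in> ?L" by (rule L.top)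
    ultimately show "A \<in> ?L" by (cases "m = 0") (auto simp: A)
  qed
  then have "sigma_sets UNIV cylinders \<subseteq> ?L"
    by (rule L.sigma_sets_subset)
  then show ?thesis
    using L sigma_algebra_sigma_sets[of cylinders UNIV]
    by (auto simp: measure_space_def positive_def countably_additive_def subset_eq)
qed

lemma space_mu [simp]: "space mu = UNIV"
  and emeasure_mu: "A \<in> sets mu \<Longrightarrow> emeasure mu A = mu_outer A"
proof -
  show "space mu = UNIV" by (simp add: mu_def)
  show "emeasure mu A = mu_outer A" if "A \<in> sets mu"
    using that measure_space_mu_outer
    by (intro emeasure_measure_of[OF mu_def]) (auto simp: measure_space_def mu_def)
qed

text \<open>As a \<open>measurable_cong\<close> rule this lets measurability questions about
  \<open>mu\<close> be answered in the product sigma-algebra.\<close>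

lemma sets_mu [measurable_cong]: "sets mu = sets (PiM UNIV (\<lambda>_::nat. borel :: real measure))"
proof -
  have "sigma_sets UNIV cylinders = sigma_sets UNIV {{f. f i \<in> A} |(i::nat) A. A \<in> sets (borel :: real measure)}"
    (is "_ = sigma_sets UNIV ?G")
  proof (rule sigma_sets_eqI)
    interpret sigma_algebra UNIV "sigma_sets UNIV ?G"
      by (rule sigma_algebra_sigma_sets) auto
    fix A assume "A \<in> cylinders"
    then obtain m C where A: "A = {x. \<forall>i<m. x i \<in> C i}" and C: "\<forall>i<m. C i \<in> sets borel"
      by (auto simp: cylinders_def)
    have "(\<Inter>i\<in>{..<m}. {x. x i \<in> C i}) \<in> sigma_sets UNIV ?G" if "m \<noteq> 0"
      using that C by (intro finite_INT) auto
    moreover have "A = (\<Inter>i\<in>{..<m}. {x. x i \<in> C i})" by (auto simp: A)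
    ultimately show "A \<in> sigma_sets UNIV ?G" by (cases "m = 0") (auto simp: A sigma_sets_top)
  next
    fix A assume "A \<in> ?G"
    then obtain i B where "A = {f. f i \<in> B}" "B \<in> sets borel" by auto
    then have "A = {x. \<forall>k<Suc i. x k \<in> (if k = i then B else UNIV)} \<and> (\<forall>k<Suc i. (if k = i then B else UNIV) \<in> sets borel)"
      by (auto split: if_splits)
    then have "A \<in> cylinders"
      unfolding cylinders_def mem_Collect_eq by (intro exI)
    then show "A \<in> sigma_sets UNIV cylinders" by auto
  qed
  then show ?thesis
    by (simp add: mu_def sets_PiM_single)
qed

section \<open>Cubes and open rectangles\<close>

lemma rect_in_sets_PiM:
  assumes [measurable]: "\<And>i. D i \<in> sets borel"
  shows "rect D \<in> sets (PiM UNIV (\<lambda>_. borel))"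
proof -
  have "Measurable.pred (PiM UNIV (\<lambda>_. borel)) (\<lambda>x. \<forall>i. x i \<in> D i)" by measurable
  then show ?thesis by (simp add: pred_def space_PiM rect_def)
qed

lemma rect_in_sets_mu: "(\<And>i. D i \<in> sets borel) \<Longrightarrow> rect D \<in> sets mu"
  unfolding sets_mu by (rule rect_in_sets_PiM)

lemma emeasure_mu_rect_le: "finite_rect D \<Longrightarrow> emeasure mu (rect D) \<le> vol D"
  by (metis emeasure_mu finite_rectD mu_outer_rect_le rect_in_sets_mu)

lemma emeasure_mu_singleton: "emeasure mu {x} = 0"
proof -
  have "eventually (\<lambda>n. partial_vol (\<lambda>i. {x i}) n = 0) sequentially"
    by (rule eventually_mono[OF eventually_gt_at_top[of 0]]) (simp add: partial_vol_def power_0_left)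
  then have "finite_rect (\<lambda>i. {x i})" "vol (\<lambda>i. {x i}) = 0"
    using finite_rect_eventually_zeroI[of "\<lambda>i. {x i}"] by auto
  moreover have "rect (\<lambda>i. {x i}) = {x}" by (auto simp: rect_def)
  ultimately show ?thesis using emeasure_mu_rect_le by fastforce
qed

text \<open>The uniform product probability on a unit cube is dominated by \<open>vol\<close> on every finite
  rectangle, hence by \<open>mu\<close>.\<close>

lemma emeasure_mu_cube_ge: "1 \<le> emeasure mu (rect (\<lambda>_. {s..s + 1}))"
proof -
  let ?U = "uniform_measure lborel {s..s + 1}"
  interpret U: prob_space ?U
    by (rule prob_space_uniform_measure) auto
  interpret sequence_space ?U ..
  have sets_S[measurable_cong]: "sets S = sets (PiM UNIV (\<lambda>_. borel))"
    by (rule sets_PiM_cong) auto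
  have rectS: "rect D \<in> sets S" if "\<And>i. D i \<in> sets borel" for D
    using that unfolding sets_S by (rule rect_in_sets_PiM)
  have Pi: "Pi UNIV D = rect D" for D by (auto simp: rect_def)
  have dom: "emeasure S (rect D) \<le> vol D" if D: "finite_rect D" for D
  proof -
    have [measurable]: "D i \<in> sets borel" for i using D by (rule finite_rectD)
    have "(\<lambda>n. ennreal (\<Prod>i\<le>n. measure ?U (D i))) \<longlonglongrightarrow> ennreal (measure S (rect D))"
      using measure_PiM_countable[of D] by (intro tendsto_ennrealI) (simp add: Pi)
    \<comment> \<open>The shift matches products over i < n in \<open>partial_vol\<close> with
      products over i <= n in \<open>measure_PiM_countable\<close>.\<close>
    moreover have "(\<lambda>n. partial_vol D (Suc n)) \<longlonglongrightarrow> vol D"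
      using partial_vol_tendsto_vol(1)[OF D] by (rule LIMSEQ_Suc)
    moreover have "ennreal (\<Prod>i\<le>n. measure ?U (D i)) \<le> partial_vol D (Suc n)" for n
    proof -
      have "ennreal (measure ?U (D i)) \<le> emeasure lborel (D i)" for i
      proof -
        have "ennreal (measure ?U (D i)) = emeasure ?U (D i)"
          by (simp only: U.emeasure_eq_measure)
        also have "\<dots> = emeasure lborel ({s..s + 1} \<inter> D i) / emeasure lborel {s..s + 1}"
          by (rule emeasure_uniform_measure) auto
        also have "\<dots> \<le> emeasure lborel (D i)"
          by (auto simp: divide_ennreal_def intro!: emeasure_mono)
        finally show ?thesis .
      qed
      then have "(\<Prod>i\<le>n. ennreal (measure ?U (D i))) \<le> (\<Prod>i\<le>n. emeasure lborel (D i))"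
        by (intro prod_mono_ennreal)
      then show ?thesis
        by (simp only: partial_vol_def prod_ennreal lessThan_Suc_atMost measure_nonneg)
    qed
    ultimately have "ennreal (measure S (rect D)) \<le> vol D"
      by (intro LIMSEQ_le) auto
    then show ?thesis by (simp add: emeasure_eq_measure)
  qed
  have "1 \<le> mu_outer (rect (\<lambda>_. {s..s + 1}))"
  proof (rule mu_outer_greatest)
    fix C assume C: "\<And>n::nat. finite_rect (C n)" "rect (\<lambda>_. {s..s + 1}) \<subseteq> (\<Union>n. rect (C n))"
    have "(\<lambda>n. \<Prod>i\<le>n. measure ?U {s..s+1}) \<longlonglongrightarrow> measure S (rect (\<lambda>_. {s..s + 1}))"
      using measure_PiM_countable[of "\<lambda>_. {s..s + 1}"] by (simp add: Pi)
    moreover have "measure ?U {s..s+1} = 1" by (simp add: measure_def)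
    ultimately have "measure S (rect (\<lambda>_. {s..s + 1})) = 1"
      by (simp add: LIMSEQ_const_iff)
    then have "1 = emeasure S (rect (\<lambda>_. {s..s + 1}))" by (simp add: emeasure_eq_measure)
    also have "\<dots> \<le> emeasure S (\<Union>n. rect (C n))"
      using C by (intro emeasure_mono) (auto intro!: rectS finite_rectD)
    also have "\<dots> \<le> (\<Sum>n. emeasure S (rect (C n)))"
      using C by (intro emeasure_subadditive_countably) (auto intro!: rectS finite_rectD)
    also have "\<dots> \<le> (\<Sum>n. vol (C n))"
      by (intro suminf_le dom C) auto
    finally show "1 \<le> (\<Sum>n. vol (C n))" .
  qed
  then show ?thesis by (simp add: emeasure_mu rect_in_sets_mu)
qed

lemma finite_rect_power:
  assumes "A \<in> sets borel" "(\<lambda>n. emeasure lborel A ^ n) \<longlonglongrightarrow> v" "v < \<infinity>"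
  shows "finite_rect (\<lambda>_. A)" "vol (\<lambda>_. A) = v"
proof -
  have "partial_vol (\<lambda>_. A) = (\<lambda>n. emeasure lborel A ^ n)"
    by (auto simp: partial_vol_def)
  then show "finite_rect (\<lambda>_. A)" "vol (\<lambda>_. A) = v"
    using assms finite_rectI[of "\<lambda>_. A" v] by auto
qed

lemma emeasure_mu_cube_finite: "emeasure mu (rect (\<lambda>_. {s..s + 1})) < \<infinity>"
proof -
  have "finite_rect (\<lambda>_. {s..s + 1})"
    by (rule finite_rect_power[of _ 1]) auto
  then show ?thesis
    using emeasure_mu_rect_le partial_vol_tendsto_vol(2) le_less_trans by blast
qed

text \<open>The partial volumes (1 - e)^n tend to 0. Hence almost no point of a unit cube keeps all
  its coordinates a fixed distance above the lower corner.\<close>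

lemma emeasure_mu_small_cube:
  assumes "0 < e" "e \<le> 1" shows "emeasure mu (rect (\<lambda>_. {s + e..s + 1})) = 0"
proof -
  have "(\<lambda>n. ennreal ((1 - e) ^ n)) \<longlonglongrightarrow> ennreal 0"
    using assms by (intro tendsto_ennrealI LIMSEQ_realpow_zero) auto
  then have "(\<lambda>n. emeasure lborel {s + e..s + 1} ^ n) \<longlonglongrightarrow> 0"
    using assms by (simp add: ennreal_power)
  then have "finite_rect (\<lambda>_. {s + e..s + 1})" "vol (\<lambda>_. {s + e..s + 1}) = 0"
    by (auto intro!: finite_rect_power)
  then show ?thesis using emeasure_mu_rect_le by fastforce
qed

text \<open>Values in \<open>ereal\<close> give an infimum also to sequences that are unbounded
  below.\<close>

lemma measurable_INF_coordinates [measurable]: "(\<lambda>y. INF i. ereal (y i)) \<in> borel_measurable mu"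
  by measurable

text \<open>A point of the cube whose infimum exceeds \<open>s\<close> lies in one of countably many
  smaller null cubes. So almost every point of a cube remembers which cube it came from, which
  separates distinct cubes.\<close>

lemma AE_cube_INF: "AE y in mu. y \<in> rect (\<lambda>_. {s..s + 1}) \<longrightarrow> (INF i. ereal (y i)) = ereal s"
proof -
  have "AE y in mu. \<forall>n. y \<notin> rect (\<lambda>_. {s + 1 / Suc n..s + 1})"
    unfolding AE_all_countable
  proof
    fix n
    have "rect (\<lambda>_. {s + 1 / Suc n..s + 1}) \<in> null_sets mu"
      using emeasure_mu_small_cube[of "1 / Suc n" s] by (auto simp: null_sets_def rect_in_sets_mu)
    then show "AE y in mu. y \<notin> rect (\<lambda>_. {s + 1 / Suc n..s + 1})" by (rule AE_not_in)
  qed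
  then show ?thesis
  proof (eventually_elim, intro impI antisym)
    fix y assume n: "\<forall>n. y \<notin> rect (\<lambda>_. {s + 1 / Suc n..s + 1})" and y: "y \<in> rect (\<lambda>_. {s..s + 1})"
    show "ereal s \<le> (INF i. ereal (y i))" using y by (intro INF_greatest) (auto simp: rect_def)
    show "(INF i. ereal (y i)) \<le> ereal s"
    proof (rule ereal_le_epsilon2)
      fix e :: real assume "0 < e"
      then obtain m where m: "1 / Suc m < e" using nat_approx_posE by metis
      from spec[OF n, of m] obtain i where "y i \<notin> {s + 1 / Suc m..s + 1}"
        unfolding rect_def by blast
      moreover have "y i \<le> s + 1" using y by (auto simp: rect_def)
      ultimately have "y i < s + 1 / Suc m" by auto
      with m have "ereal (y i) \<le> ereal s + ereal e" by simp
      then show "(INF i. ereal (y i)) \<le> ereal s + ereal e" by (rule INF_lower2[rotated]) simp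
    qed
  qed
qed

section \<open>Open enlargements of rectangles and their coding by reals\<close>

text \<open>Side i grows by a relative factor of at most 1 + 2^-i <= exp (2^-i), so the total growth
  stays below exp 2. The aim is convergence to a finite volume, not closeness to
  \<open>vol C\<close>. Nonzero volume makes every side positive and finite, so that relative growth
  makes sense.\<close>

lemma finite_rect_open_superset:
  assumes C: "finite_rect C" "vol C \<noteq> 0"
  obtains U where "\<And>i. open (U i)" "finite_rect U" "rect C \<subseteq> rect U"
proof -
  have nz: "emeasure lborel (C i) \<noteq> 0" for i
  proof
    assume "emeasure lborel (C i) = 0"
    then have "partial_vol C n = 0" if "i < n" for n
      using partial_vol_remove[OF that, of C "C i"] by simp
    then have "vol C = 0"
      using finite_rectD[OF C(1)] by (intro finite_rect_eventually_zeroI) (auto intro: eventually_mono[OF eventually_gt_at_top[of i]])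
    with C show False by simp
  qed
  \<comment> \<open>All sides being non-null, one infinite side would make every late partial volume
    infinite.\<close>
  have fin: "emeasure lborel (C i) \<noteq> \<infinity>" for i
  proof
    assume "emeasure lborel (C i) = \<infinity>"
    then have *: "partial_vol C n = \<infinity>" if "i < n" for n
      using partial_vol_remove[OF that, of C "C i"] nz by (simp add: ennreal_top_mult)
    have "eventually (\<lambda>n. partial_vol C n < \<infinity>) sequentially"
      using partial_vol_tendsto_vol[OF C(1)] by (rule order_tendstoD)
    then have "eventually (\<lambda>n. False) sequentially"
      using eventually_gt_at_top[of i] by eventually_elim (use * in auto)
    then show False by simp
  qed
  define c where "c i = measure lborel (C i)" for i
  have c: "emeasure lborel (C i) = ennreal (c i)" "0 < c i" for i
  proof -
    show "emeasure lborel (C i) = ennreal (c i)"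
      using fin[of i] by (simp add: c_def emeasure_eq_ennreal_measure)
    then show "0 < c i" using nz[of i] by (auto simp: ennreal_eq_0_iff not_le)
  qed
  \<comment> \<open>The tolerance is proportional to the side, since absolute errors would not
    control the product.\<close>
  have "\<exists>U. open U \<and> C i \<subseteq> U \<and> emeasure lborel (U - C i) < ennreal (c i * (1/2) ^ i)" for i
    by (rule outer_regular_lborel[of "C i" "c i * (1/2) ^ i"]) (use finite_rectD[OF C(1)] c in auto)
  then obtain U where U: "\<And>i. open (U i)" "\<And>i. C i \<subseteq> U i" "\<And>i. emeasure lborel (U i - C i) < ennreal (c i * (1/2) ^ i)"
    by metis
  define r where "r i = emeasure lborel (U i) / ennreal (c i)" for i
  have Ur: "emeasure lborel (U i) = r i * ennreal (c i)" for i
    using c(2)[of i] by (simp add: r_def ennreal_divide_times mult_divide_eq_ennreal)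
  have r1: "1 \<le> r i" for i
  proof -
    have "ennreal (c i) / ennreal (c i) \<le> r i"
      unfolding r_def c(1)[symmetric] using U by (intro divide_right_mono_ennreal emeasure_mono) auto
    then show ?thesis using c(2)[of i] by (simp add: ennreal_divide_self)
  qed
  have r2: "r i \<le> ennreal (exp ((1/2) ^ i))" for i
  proof -
    have Cb: "C i \<in> sets borel" using finite_rectD[OF C(1)] .
    have "emeasure lborel (U i) = emeasure lborel (C i) + emeasure lborel (U i - C i)"
      using U Cb by (subst plus_emeasure) (auto simp: Un_absorb1 intro!: arg_cong[where f="emeasure lborel"])
    also have "\<dots> \<le> ennreal (c i) + ennreal (c i * (1/2) ^ i)"
      using U(3)[of i] c(1) by (intro add_mono) auto
    also have "\<dots> = ennreal (1 + (1/2) ^ i) * ennreal (c i)"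
      using c(2)[of i] by (simp add: ennreal_plus[symmetric] ennreal_mult[symmetric] algebra_simps del: ennreal_plus)
    finally have "r i \<le> ennreal (1 + (1/2) ^ i) * ennreal (c i) / ennreal (c i)"
      unfolding r_def by (rule divide_right_mono_ennreal)
    also have "\<dots> = ennreal (1 + (1/2) ^ i)"
      using c(2)[of i] by (simp add: mult_divide_eq_ennreal)
    also have "\<dots> \<le> ennreal (exp ((1/2) ^ i))"
      by (intro ennreal_leI) (rule exp_ge_add_one_self)
    finally show ?thesis .
  qed
  \<comment> \<open>The growth factors are at least 1, so their partial products increase and have a
    limit.\<close>
  define P where "P n = (\<Prod>i<n. r i)" for n
  have "incseq P"
  proof (rule incseq_SucI)
    show "P n \<le> P (Suc n)" for n
      using mult_left_mono[OF r1[of n], of "P n"] by (simp add: P_def)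
  qed
  then have P: "P \<longlonglongrightarrow> (SUP n. P n)" by (rule LIMSEQ_SUP)
  have "P n \<le> ennreal (exp 2)" for n
  proof -
    have "P n \<le> (\<Prod>i<n. ennreal (exp ((1/2) ^ i)))"
      unfolding P_def by (intro prod_mono_ennreal r2)
    also have "\<dots> = ennreal (exp (\<Sum>i<n. (1/2) ^ i))"
      by (simp add: prod_ennreal exp_sum)
    also have "\<dots> \<le> ennreal (exp 2)"
    proof (intro ennreal_leI, subst exp_le_cancel_iff)
      have "(\<Sum>i<n. (1/2) ^ i) \<le> (\<Sum>i. (1/2::real) ^ i)"
        by (rule sum_le_suminf) (auto simp: summable_geometric)
      then show "(\<Sum>i<n. (1/2) ^ i) \<le> (2::real)"
        using suminf_geometric[of "1/2::real"] by simp
    qed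
    finally show ?thesis .
  qed
  then have P_le: "(SUP n. P n) \<le> ennreal (exp 2)" by (intro SUP_least)
  then have P_fin: "(SUP n. P n) < \<infinity>"
    by (metis ennreal_less_top infinity_ennreal_def order_le_less_trans)
  have PU: "partial_vol U n = P n * partial_vol C n" for n
    by (simp add: partial_vol_def P_def prod.distrib[symmetric] Ur c(1))
  have "(\<lambda>n. P n * partial_vol C n) \<longlonglongrightarrow> (SUP n. P n) * vol C"
  proof (intro tendsto_mult_ennreal P partial_vol_tendsto_vol C)
    show "\<not> ((SUP n. P n) = 0 \<and> vol C = \<infinity> \<or> (SUP n. P n) = \<infinity> \<and> vol C = 0)"
      using P_fin C(2) partial_vol_tendsto_vol(2)[OF C(1)] by (metis less_irrefl)
  qed
  then have "partial_vol U \<longlonglongrightarrow> (SUP n. P n) * vol C"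
    by (simp add: PU[abs_def])
  moreover have "(SUP n. P n) * vol C < \<infinity>"
    using P_fin partial_vol_tendsto_vol(2)[OF C(1)] by (simp add: ennreal_mult_less_top)
  ultimately have "finite_rect U"
    using U(1) by (intro finite_rectI) auto
  moreover have "rect C \<subseteq> rect U" using U(2) by (auto simp: rect_def)
  ultimately show ?thesis using U(1) that by blast
qed

text \<open>An open set is given by the indices of the basic sets composing it, so a sequence of
  open sets is a set of pairs, hence a set of naturals, hence a real. Different reals may code the
  same sequence; a repeated rectangle only yields an empty piece later.\<close>

lemma open_sequences_indexed_by_reals:
  obtains R :: "real \<Rightarrow> nat \<Rightarrow> real set"
  where "\<And>a i. open (R a i)" "\<And>U. (\<And>i. open (U i)) \<Longrightarrow> \<exists>a. R a = U"
proof -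
  obtain B :: "nat \<Rightarrow> real set" where B: "\<And>n. open (B n)" "\<And>S. open S \<Longrightarrow> \<exists>k. S = \<Union>{B n |n. n \<in> k}"
    by (rule univ_second_countable_sequence) (rule that)
  obtain f where "bij_betw f (UNIV :: nat set set) (UNIV :: real set)"
    using nat_sets_eqpoll_reals unfolding eqpoll_def ..
  then have "inj f" by (rule bij_is_inj)
  define \<phi> where "\<phi> = inv f"
  have surj: "\<exists>a. \<phi> a = K" for K
    by (rule exI[of _ "f K"]) (simp add: \<phi>_def inv_f_f[OF \<open>inj f\<close>])
  show ?thesis
  proof (rule that[of "\<lambda>a i. \<Union>{B n |n. prod_encode (i, n) \<in> \<phi> a}"])
    show "open (\<Union>{B n |n. prod_encode (i, n) \<in> \<phi> a})" for a i
      using B by auto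
    fix U :: "nat \<Rightarrow> real set" assume "\<And>i. open (U i)"
    then have "\<forall>i. \<exists>k. U i = \<Union>{B n |n. n \<in> k}" using B(2) by auto
    then obtain k where "\<forall>i. U i = \<Union>{B n |n. n \<in> k i}" by (rule choice[THEN exE])
    then have k: "U i = \<Union>{B n |n. n \<in> k i}" for i ..
    obtain a where a: "\<phi> a = {prod_encode (i, n) |i n. n \<in> k i}" using surj ..
    have "prod_encode (i, n) \<in> \<phi> a \<longleftrightarrow> n \<in> k i" for i n by (auto simp: a)
    then show "\<exists>a. (\<lambda>i. \<Union>{B n |n. prod_encode (i, n) \<in> \<phi> a}) = U"
      by (intro exI[of _ a] ext) (simp add: k)
  qed
qed

text \<open>A cardinal well-order is minimal, so its proper initial segments are smaller than the
  continuum and CH makes them countable. An arbitrary well-order of the reals need not have this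
  property.\<close>

lemma CH_well_order:
  assumes CH
  obtains r :: "real rel" where "Well_order r" "Field r = UNIV" "\<And>a. countable (underS r a)"
proof (rule that[of "card_of UNIV"])
  show "Well_order (card_of (UNIV :: real set))" by (rule card_of_Well_order)
  show F: "Field (card_of (UNIV :: real set)) = UNIV" by (rule Field_card_of)
  show "countable (underS (card_of (UNIV :: real set)) a)" for a
  proof -
    have "(card_of (underS (card_of (UNIV :: real set)) a), card_of (UNIV :: real set)) \<in> ordLess"
      by (rule card_of_underS[OF card_of_Card_order]) (simp only: F UNIV_I)
    then have "\<not> (\<exists>f. bij_betw f (underS (card_of (UNIV :: real set)) a) (UNIV :: real set))"
      by (metis card_of_ordIso not_ordLess_ordIso)
    moreover have "countable (underS (card_of (UNIV :: real set)) a) \<or>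
        (\<exists>f. bij_betw f (underS (card_of (UNIV :: real set)) a) (UNIV :: real set))"
      using assms unfolding CH_def ..
    ultimately show ?thesis by (simp only: simp_thms)
  qed
qed

section \<open>Decomposition under CH\<close>

text \<open>A covering rectangle of positive volume is enlarged to an open one. One of volume 0 may
  have no such enlargement, but it is null and is replaced by the empty rectangle; this is the
  source of the exceptional null set.\<close>

lemma emeasure_mu_finite_cover:
  assumes A: "A \<in> sets mu" "emeasure mu A < \<infinity>"
  obtains U :: "nat \<Rightarrow> nat \<Rightarrow> real set" where "\<And>n i. open (U n i)" "\<And>n. finite_rect (U n)" "A - (\<Union>n. rect (U n)) \<in> null_sets mu"
proof -
  from A have "mu_outer A < \<infinity>" by (simp add: emeasure_mu)
  then obtain C :: "nat \<Rightarrow> nat \<Rightarrow> real set" where C: "\<And>n. finite_rect (C n)" "A \<subseteq> (\<Union>n. rect (C n))"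
    using mu_outer_cover[of A \<infinity>] by metis
  have "\<exists>U. (\<forall>i. open (U i)) \<and> finite_rect U \<and> rect (C n) - rect U \<in> null_sets mu" for n
  proof (cases "vol (C n) = 0")
    case True
    then have "rect (C n) \<in> null_sets mu"
      using emeasure_mu_rect_le[OF C(1)[of n]] C(1) by (auto simp: null_sets_def intro!: rect_in_sets_mu finite_rectD)
    then show ?thesis
      by (intro exI[of _ "\<lambda>_. {}"]) (auto simp: finite_rect_empty rect_def)
  next
    case False
    obtain U where "\<And>i. open (U i)" "finite_rect U" "rect (C n) \<subseteq> rect U"
      using finite_rect_open_superset[OF C(1) False] by blast
    then show ?thesis by (intro exI[of _ U]) (auto simp: Diff_eq_empty_iff[THEN iffD2])
  qed
  then have "\<forall>n. \<exists>U. (\<forall>i. open (U i)) \<and> finite_rect U \<and> rect (C n) - rect U \<in> null_sets mu" ..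
  then obtain U where U: "\<forall>n. (\<forall>i. open (U n i)) \<and> finite_rect (U n) \<and> rect (C n) - rect (U n) \<in> null_sets mu"
    by (rule choice[THEN exE])
  show ?thesis
  proof (rule that[of U])
    have "(\<Union>n. rect (C n) - rect (U n)) \<in> null_sets mu" using U by (intro null_sets_UN) auto
    moreover have "A - (\<Union>n. rect (U n)) \<in> sets mu"
      using A U by (auto intro!: rect_in_sets_mu finite_rectD)
    moreover have "A - (\<Union>n. rect (U n)) \<subseteq> (\<Union>n. rect (C n) - rect (U n))"
      using C(2) by auto
    ultimately show "A - (\<Union>n. rect (U n)) \<in> null_sets mu" by (rule null_sets_subset)
  qed (use U in auto)
qed

text \<open>Under CH the open finite rectangles are enumerated in type \<open>\<omega>\<^sub>1\<close>, so removing from each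
  one its predecessors keeps it measurable.\<close>

lemma mu_decomposition:
  assumes CH
  obtains E :: "real \<Rightarrow> (nat \<Rightarrow> real) set"
  where "\<And>a. E a \<in> sets mu" "\<And>a. emeasure mu (E a) < \<infinity>" "disjoint_family E"
    "\<And>A. A \<in> sets mu \<Longrightarrow> emeasure mu A < \<infinity> \<Longrightarrow> \<exists>J. countable J \<and> A - (\<Union>a\<in>J. E a) \<in> null_sets mu"
proof -
  obtain R :: "real \<Rightarrow> nat \<Rightarrow> real set"
    where R: "\<And>a i. open (R a i)" "\<And>U. (\<And>i. open (U i)) \<Longrightarrow> \<exists>a. R a = U"
    using open_sequences_indexed_by_reals by blast
  obtain r :: "real rel" where r: "Well_order r" "Field r = UNIV" "\<And>a. countable (underS r a)"
    using CH_well_order[OF assms] by blast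
  \<comment> \<open>Codes of rectangles without finite volume get the empty set, so that
    \<open>W\<close> is indexed by all reals.\<close>
  define W where "W a = (if finite_rect (R a) then rect (R a) else {})" for a
  define E where "E a = W a - (\<Union>b\<in>underS r a. W b)" for a
  have W[measurable]: "W a \<in> sets mu" for a by (auto simp: W_def intro!: rect_in_sets_mu finite_rectD)
  have W_fin: "emeasure mu (W a) < \<infinity>" for a
    using emeasure_mu_rect_le[of "R a"] partial_vol_tendsto_vol(2)[of "R a"] by (auto simp: W_def)
  have total: "(a, b) \<in> r \<or> (b, a) \<in> r" if "a \<noteq> b" for a b
    using r that by (auto simp: well_order_on_def linear_order_on_def total_on_def)
  have wf: "wf (r - Id)" using r(1) by (simp add: well_order_on_def)
  \<comment> \<open>A point belongs to the piece of the first \<open>W b\<close> that contains it,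
    and this \<open>b\<close> is \<open>a\<close> or precedes \<open>a\<close>.\<close>
  have W_cover: "W a \<subseteq> (\<Union>b\<in>insert a (underS r a). E b)" for a
  proof
    fix x assume x: "x \<in> W a"
    then obtain b where b: "x \<in> W b" "\<And>c. (c, b) \<in> r - Id \<Longrightarrow> x \<notin> W c"
      using wfE_min[OF wf, of a "{b. x \<in> W b}"] by auto
    have "x \<in> E b" using b by (auto simp: E_def underS_def)
    moreover have "b \<in> insert a (underS r a)"
      using total[of a b] b(2)[of a] x by (auto simp: underS_def)
    ultimately show "x \<in> (\<Union>b\<in>insert a (underS r a). E b)" by auto
  qed
  show ?thesis
  proof (rule that)
    show "E a \<in> sets mu" for a
      using r(3) W unfolding E_def by (intro sets.Diff sets.countable_UN') auto
    have "emeasure mu (E a) \<le> emeasure mu (W a)" for a by (intro emeasure_mono) (auto simp: E_def)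
    then show "emeasure mu (E a) < \<infinity>" for a using W_fin by (rule le_less_trans)
    show "disjoint_family E"
      unfolding disjoint_family_on_def
    proof (intro ballI impI)
      fix a b :: real assume "a \<noteq> b"
      then consider "a \<in> underS r b" | "b \<in> underS r a" using total[of a b] by (auto simp: underS_def)
      then show "E a \<inter> E b = {}" by cases (auto simp: E_def)
    qed
    fix A assume A: "A \<in> sets mu" "emeasure mu A < \<infinity>"
    then obtain U :: "nat \<Rightarrow> nat \<Rightarrow> real set" where U: "\<And>n i. open (U n i)" "\<And>n. finite_rect (U n)" "A - (\<Union>n. rect (U n)) \<in> null_sets mu"
      using emeasure_mu_finite_cover[of A] by blast
    have "\<forall>n. \<exists>a. R a = U n" using R(2) U(1) by auto
    then obtain \<alpha> where "\<forall>n. R (\<alpha> n) = U n" by (rule choice[THEN exE])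
    then have \<alpha>: "W (\<alpha> n) = rect (U n)" for n using U(2) by (simp add: W_def)
    \<comment> \<open>All predecessors must be included: the part of a rectangle removed from its
      own piece lies in theirs.\<close>
    let ?J = "\<Union>n. insert (\<alpha> n) (underS r (\<alpha> n))"
    have J: "countable ?J" using r(3) by auto
    have "(\<Union>n. rect (U n)) \<subseteq> (\<Union>a\<in>?J. E a)" using W_cover[of "\<alpha> _"] unfolding \<alpha> by blast
    then have "A - (\<Union>a\<in>?J. E a) \<subseteq> A - (\<Union>n. rect (U n))" by blast
    moreover have "A - (\<Union>a\<in>?J. E a) \<in> sets mu"
      using A J \<open>\<And>a. E a \<in> sets mu\<close> by (intro sets.Diff sets.countable_UN') auto
    ultimately have "A - (\<Union>a\<in>?J. E a) \<in> null_sets mu" using U(3) null_sets_subset by blast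
    with J show "\<exists>J. countable J \<and> A - (\<Union>a\<in>J. E a) \<in> null_sets mu" by blast
  qed
qed

text \<open>The coordinate infimum is almost surely constant on each unit cube, so the cubes that meet
  a fixed finite piece in positive measure produce distinct atoms of one finite measure.\<close>

lemma countable_cubes_meeting:
  assumes E: "E \<in> sets mu" "emeasure mu E < \<infinity>"
  shows "countable {s. emeasure mu (E \<inter> rect (\<lambda>_. {s..s + 1})) \<noteq> 0}"
proof -
  note [measurable] = E(1)
  define N where "N = distr (restrict_space mu E) borel (\<lambda>y. INF i. ereal (y i))"
  have g: "(\<lambda>y. INF i. ereal (y i)) \<in> borel_measurable (restrict_space mu E)"
    by (rule measurable_restrict_space1) measurable
  have N: "emeasure N A = emeasure mu (E \<inter> (\<lambda>y. INF i. ereal (y i)) -` A)" if "A \<in> sets borel" for A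
    using that g E by (simp add: N_def emeasure_distr space_restrict_space emeasure_restrict_space Int_commute)
  interpret finite_measure N
    using E N[of UNIV] by (intro finite_measureI) (auto simp: N_def)
  have "emeasure N {ereal s} \<noteq> 0" if s: "emeasure mu (E \<inter> rect (\<lambda>_. {s..s + 1})) \<noteq> 0" for s
  proof -
    have [measurable]: "rect (\<lambda>_. {s..s + 1}) \<in> sets mu" by (rule rect_in_sets_mu) auto
    have "emeasure mu (E \<inter> rect (\<lambda>_. {s..s + 1})) \<le> emeasure mu (E \<inter> (\<lambda>y. INF i. ereal (y i)) -` {ereal s})"
    proof (rule emeasure_mono_AE)
      show "AE x in mu. x \<in> E \<inter> rect (\<lambda>_. {s..s + 1}) \<longrightarrow> x \<in> E \<inter> (\<lambda>y. INF i. ereal (y i)) -` {ereal s}"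
        using AE_cube_INF[of s] by eventually_elim auto
      have "(\<lambda>y. INF i. ereal (y i)) -` {ereal s} \<inter> space mu \<in> sets mu"
        by (rule measurable_sets[OF measurable_INF_coordinates]) simp
      then show "E \<inter> (\<lambda>y. INF i. ereal (y i)) -` {ereal s} \<in> sets mu" using E(1) by auto
    qed
    with s show ?thesis by (subst N) (auto simp: le_zero_eq)
  qed
  then have "ereal ` {s. emeasure mu (E \<inter> rect (\<lambda>_. {s..s + 1})) \<noteq> 0} \<subseteq> {x. measure N {x} \<noteq> 0}"
    by (auto simp: emeasure_eq_measure)
  then have "countable (ereal ` {s. emeasure mu (E \<inter> rect (\<lambda>_. {s..s + 1})) \<noteq> 0})"
    using countable_support countable_subset by blast
  then show ?thesis
    by (rule countable_image_inj_on) (auto simp: inj_on_def)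
qed

text \<open>Discarding null pieces changes a countable cover by a null set only. Were countably many
  pieces left, they would meet only countably many unit cubes in positive measure, while every unit
  cube must meet one of them so.\<close>

lemma mu_positive_decomposition:
  assumes CH
  obtains E :: "real \<Rightarrow> (nat \<Rightarrow> real) set"
  where "\<And>a. E a \<in> sets mu" "\<And>a. emeasure mu (E a) < \<infinity>" "\<And>a. emeasure mu (E a) \<noteq> 0" "disjoint_family E"
    "\<And>A. A \<in> sets mu \<Longrightarrow> emeasure mu A < \<infinity> \<Longrightarrow> \<exists>J. countable J \<and> A - (\<Union>a\<in>J. E a) \<in> null_sets mu"
proof -
  obtain E :: "real \<Rightarrow> (nat \<Rightarrow> real) set"
    where E[measurable]: "\<And>a. E a \<in> sets mu" and fin: "\<And>a. emeasure mu (E a) < \<infinity>" and disj: "disjoint_family E"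
      and cover: "\<And>A. A \<in> sets mu \<Longrightarrow> emeasure mu A < \<infinity> \<Longrightarrow> \<exists>J. countable J \<and> A - (\<Union>a\<in>J. E a) \<in> null_sets mu"
    using mu_decomposition[OF assms] by blast
  define P where "P = {a. emeasure mu (E a) \<noteq> 0}"
  have cover': "\<exists>J. countable J \<and> J \<subseteq> P \<and> A - (\<Union>a\<in>J. E a) \<in> null_sets mu"
    if A: "A \<in> sets mu" "emeasure mu A < \<infinity>" for A
  proof -
    from cover[OF A] obtain J where J: "countable J" "A - (\<Union>a\<in>J. E a) \<in> null_sets mu" by auto
    have "(\<Union>a\<in>J - P. E a) \<in> null_sets mu"
      using J by (intro null_sets_UN') (auto simp: P_def null_sets_def)
    with J have "(A - (\<Union>a\<in>J. E a)) \<union> (\<Union>a\<in>J - P. E a) \<in> null_sets mu" by auto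
    moreover have "A - (\<Union>a\<in>J \<inter> P. E a) \<in> sets mu"
      using A J by (intro sets.Diff sets.countable_UN') auto
    moreover have "A - (\<Union>a\<in>J \<inter> P. E a) \<subseteq> (A - (\<Union>a\<in>J. E a)) \<union> (\<Union>a\<in>J - P. E a)" by auto
    ultimately have "A - (\<Union>a\<in>J \<inter> P. E a) \<in> null_sets mu" by (rule null_sets_subset)
    with J show ?thesis by (intro exI[of _ "J \<inter> P"]) auto
  qed
  have "uncountable P"
  proof
    assume P: "countable P"
    \<comment> \<open>Otherwise countably many null intersections and a null remainder would cover a
      cube of measure at least 1.\<close>
    have "\<exists>a\<in>P. emeasure mu (E a \<inter> rect (\<lambda>_. {s..s + 1})) \<noteq> 0" for s :: real
    proof (rule ccontr)
      let ?Q = "rect (\<lambda>_. {s..s + 1})"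
      assume *: "\<not> ?thesis"
      have Q: "?Q \<in> sets mu" by (rule rect_in_sets_mu) auto
      from cover'[OF Q emeasure_mu_cube_finite] obtain J
        where J: "countable J" "J \<subseteq> P" "?Q - (\<Union>a\<in>J. E a) \<in> null_sets mu" by auto
      have "(\<Union>a\<in>J. E a \<inter> ?Q) \<in> null_sets mu"
        using * J Q by (intro null_sets_UN') (auto simp: null_sets_def)
      with J(3) have "(?Q - (\<Union>a\<in>J. E a)) \<union> (\<Union>a\<in>J. E a \<inter> ?Q) \<in> null_sets mu" by auto
      moreover have "?Q \<subseteq> (?Q - (\<Union>a\<in>J. E a)) \<union> (\<Union>a\<in>J. E a \<inter> ?Q)" by auto
      ultimately have "?Q \<in> null_sets mu" using Q null_sets_subset by blast
      with emeasure_mu_cube_ge[of s] show False by (auto simp: null_sets_def)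
    qed
    then have "UNIV = (\<Union>a\<in>P. {s. emeasure mu (E a \<inter> rect (\<lambda>_. {s..s + 1})) \<noteq> 0})" by auto
    moreover have "countable \<dots>"
      using P fin by (intro countable_UN countable_cubes_meeting) auto
    ultimately show False using uncountable_UNIV_real by simp
  qed
  then obtain f where f: "bij_betw f P (UNIV :: real set)"
    using assms unfolding CH_def by auto
  \<comment> \<open>Reindexing along the bijection makes the reals themselves the index set.\<close>
  let ?g = "inv_into P f"
  have g: "?g j \<in> P" for j using bij_betw_inv_into[OF f] by (auto simp: bij_betw_def)
  have inj: "inj ?g" using bij_betw_inv_into[OF f] by (simp add: bij_betw_def)
  show ?thesis
  proof (rule that[of "\<lambda>j. E (?g j)"])
    show "emeasure mu (E (?g j)) \<noteq> 0" for j using g[of j] by (simp add: P_def)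
    show "disjoint_family (\<lambda>j. E (?g j))"
      using disj inj by (auto simp: disjoint_family_on_def inj_on_def)
    fix A assume "A \<in> sets mu" "emeasure mu A < \<infinity>"
    from cover'[OF this] obtain J where J: "countable J" "J \<subseteq> P" "A - (\<Union>a\<in>J. E a) \<in> null_sets mu" by auto
    have "(\<Union>j\<in>f ` J. E (?g j)) = (\<Union>a\<in>J. E a)"
      using J(2) bij_betw_imp_inj_on[OF f] by (auto simp: subset_iff)
    with J show "\<exists>J. countable J \<and> A - (\<Union>j\<in>J. E (?g j)) \<in> null_sets mu"
      by (intro exI[of _ "f ` J"]) auto
  qed (use E fin in auto)
qed

section \<open>Atomless probabilities on sequences\<close>

text \<open>Base 3 with digits 0 and 1 avoids double expansions: the digits after a given place
  contribute at most half a unit of that place. Base 2 would be ambiguous.\<close>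

definition ternary :: "(nat \<Rightarrow> bool) \<Rightarrow> real" where
  "ternary b = (\<Sum>n. if b n then (1/3) ^ Suc n else 0)"

text \<open>On values of \<open>ternary\<close>, leading digit 0 means at most 1/6 and leading digit
  1 at least 1/3, which explains the threshold; the recursion then shifts the expansion by one
  place.\<close>

primrec ternary_digit :: "nat \<Rightarrow> real \<Rightarrow> bool" where
  "ternary_digit 0 t \<longleftrightarrow> 1/3 \<le> t"
| "ternary_digit (Suc n) t \<longleftrightarrow> ternary_digit n (3 * t - (if 1/3 \<le> t then 1 else 0))"

lemma ternary_sums: "(\<lambda>n. (1/3) ^ Suc n) sums (1/2 :: real)"
  using sums_mult[OF geometric_sums[of "1/3 :: real"], of "1/3"] by simp

lemma summable_ternary: "summable (\<lambda>n. if b n then (1/3 :: real) ^ Suc n else 0)"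
  by (rule summable_comparison_test'[OF sums_summable[OF ternary_sums], of 0]) auto

lemma ternary_nonneg: "0 \<le> ternary b"
  unfolding ternary_def by (rule suminf_nonneg[OF summable_ternary]) auto

lemma ternary_le: "ternary b \<le> 1/2"
  unfolding ternary_def sums_unique[OF ternary_sums]
  by (rule suminf_le[OF _ summable_ternary sums_summable[OF ternary_sums]]) auto

lemma ternary_shift: "3 * ternary b = (if b 0 then 1 else 0) + ternary (\<lambda>n. b (Suc n))"
proof -
  have "3 * ternary b = (\<Sum>n. 3 * (if b n then (1/3) ^ Suc n else 0))"
    unfolding ternary_def by (rule suminf_mult[OF summable_ternary, symmetric])
  also have "\<dots> = (\<Sum>n. 3 * (if b (Suc n) then (1/3) ^ Suc (Suc n) else 0)) + (if b 0 then 1 else 0)"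
    using suminf_split_head[OF summable_mult[OF summable_ternary[of b], of 3]] by simp
  also have "(\<lambda>n. 3 * (if b (Suc n) then (1/3) ^ Suc (Suc n) else 0 :: real)) = (\<lambda>n. if b (Suc n) then (1/3) ^ Suc n else 0)"
    by auto
  finally show ?thesis by (simp add: ternary_def)
qed

lemma ternary_digit_ternary: "ternary_digit n (ternary b) = b n"
proof (induction n arbitrary: b)
  have first: "1/3 \<le> ternary b \<longleftrightarrow> b 0" for b
    using ternary_shift[of b] ternary_nonneg[of "\<lambda>n. b (Suc n)"] ternary_le[of "\<lambda>n. b (Suc n)"]
    by (auto split: if_splits)
  case 0
  show ?case using first by simp
  case (Suc n)
  have "3 * ternary b - (if b 0 then 1 else 0) = ternary (\<lambda>n. b (Suc n))"
    using ternary_shift[of b] by simp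
  then show ?case using Suc[of "\<lambda>n. b (Suc n)"] first by simp
qed

lemma measurable_ternary_digit [measurable]: "Measurable.pred borel (ternary_digit n)"
proof (induction n)
  case 0
  show ?case by simp
next
  case (Suc n)
  note [measurable] = this
  show ?case by simp
qed

text \<open>A real is recovered from the truth values of q < x for rational q; the value
  \<open>- \<infinity>\<close> is neutral in the supremum.\<close>

lemma SUP_rat_less: "(SUP m. if real_of_rat (from_nat m) < x then ereal (real_of_rat (from_nat m)) else - \<infinity>) = ereal x"
proof (rule SUP_eqI)
  fix y assume y: "\<And>m. m \<in> UNIV \<Longrightarrow> (if real_of_rat (from_nat m) < x then ereal (real_of_rat (from_nat m)) else - \<infinity>) \<le> y"
  have q: "ereal (real_of_rat q) \<le> y" if "real_of_rat q < x" for q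
    using y[of "to_nat q"] that by simp
  show "ereal x \<le> y"
  proof (rule ccontr)
    assume "\<not> ereal x \<le> y"
    then have "y < ereal x" by simp
    then obtain z where z: "y < ereal z" "ereal z < ereal x"
      using ereal_dense2[of y "ereal x"] by auto
    then obtain q where "z < real_of_rat q" "real_of_rat q < x"
      using of_rat_dense[of z x] by auto
    with q[of q] z show False by (meson ereal_less_eq(3) leD less_ereal.simps(1) less_le_trans order_less_trans)
  qed
qed auto

text \<open>A sequence is determined by countably many bits, each telling whether a given rational
  lies below a given coordinate. Packing them into one ternary number and reading them back are
  countable operations, hence measurable.\<close>

lemma real_sequences_embed_in_real:
  obtains h :: "(nat \<Rightarrow> real) \<Rightarrow> real" and k :: "real \<Rightarrow> nat \<Rightarrow> real"
  where "h \<in> borel_measurable (PiM UNIV (\<lambda>_. borel))" "k \<in> borel \<rightarrow>\<^sub>M PiM UNIV (\<lambda>_. borel)" "\<And>x. k (h x) = x"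
proof
  let ?q = "\<lambda>m. real_of_rat (from_nat m)"
  let ?h = "\<lambda>x :: nat \<Rightarrow> real. ternary (\<lambda>n. ?q (snd (prod_decode n)) < x (fst (prod_decode n)))"
  \<comment> \<open>Off the range of \<open>?h\<close> the supremum may be infinite;
    \<open>real_of_ereal\<close> then returns 0.\<close>
  let ?k = "\<lambda>t i. real_of_ereal (SUP m. if ternary_digit (prod_encode (i, m)) t then ereal (?q m) else - \<infinity>)"
  show "?h \<in> borel_measurable (PiM UNIV (\<lambda>_. borel))"
    unfolding ternary_def by measurable
  show "?k \<in> borel \<rightarrow>\<^sub>M PiM UNIV (\<lambda>_. borel)"
    proof (rule measurable_PiM_single')
    have [measurable]: "(\<lambda>t. if ternary_digit n t then ereal c else - \<infinity>) \<in> borel_measurable borel" for n c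
      using measurable_ternary_digit[of n] by (intro measurable_If) (auto simp: pred_def)
    show "(\<lambda>t. ?k t i) \<in> borel_measurable borel" for i
      by measurable
  qed (auto simp: space_PiM)
  show "?k (?h x) = x" for x
    by (simp only: ternary_digit_ternary prod_encode_inverse fst_conv snd_conv SUP_rat_less real_of_ereal.simps)
qed

text \<open>\<open>G\<close> is the pseudoinverse \<open>I\<close> of the distribution function
  \<open>C\<close>, and \<open>F\<close> is \<open>C\<close>. The quantile function always
  transports Lebesgue measure to \<open>N\<close>; having no atoms makes \<open>C\<close>
  continuous, and this gives F (G t) = t.\<close>

lemma quantile_transform:
  assumes "real_distribution N" "\<And>x. measure N {x} = 0"
  obtains F G :: "real \<Rightarrow> real" where "F \<in> borel_measurable borel" "G \<in> borel_measurable borel"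
    "\<And>A. A \<in> sets borel \<Longrightarrow> emeasure lborel (G -` A \<inter> {0<..<1}) = emeasure N A"
    "\<And>t. 0 < t \<Longrightarrow> t < 1 \<Longrightarrow> F (G t) = t"
proof -
  interpret cdf_distribution N using assms(1) by (simp add: cdf_distribution_def)
  \<comment> \<open>\<open>I\<close> is meaningful only on the open unit interval, so it is extended
    by 0.\<close>
  have G: "(\<lambda>t. if t \<in> {0<..<1} then I t else 0) \<in> borel_measurable borel"
    using measurable_CI
    by (subst measurable_If_restrict_space_iff)
       (auto simp: greaterThanLessThan_def greaterThan_def lessThan_def Int_def)
  show ?thesis
  proof (rule that[OF measurable_C G])
    fix A :: "real set" assume A: "A \<in> sets borel"
    have "emeasure N A = emeasure (distr (restrict_space lborel {0<..<1}) borel I) A"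
      by (simp add: distr_I_eq_M)
    also have "\<dots> = emeasure (restrict_space lborel {0<..<1}) (I -` A \<inter> {0<..<1})"
      using A by (subst emeasure_distr) (auto simp: space_restrict_space measurable_lborel1 cong: measurable_cong_sets)
    also have "\<dots> = emeasure lborel (I -` A \<inter> {0<..<1})"
      by (rule emeasure_restrict_space) auto
    also have "I -` A \<inter> {0<..<1} = (\<lambda>t. if t \<in> {0<..<1} then I t else 0) -` A \<inter> {0<..<1}"
      by (auto split: if_splits)
    finally show "emeasure lborel ((\<lambda>t. if t \<in> {0<..<1} then I t else 0) -` A \<inter> {0<..<1}) = emeasure N A" ..
  next
    fix t :: real assume t: "0 < t" "t < 1"
    \<comment> \<open>To the left of \<open>I t\<close> the values of \<open>C\<close> are at most
      t, and continuity carries the bound to \<open>I t\<close>.\<close>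
    have "C (I t) \<le> t"
    proof (rule tendsto_upperbound)
      have "isCont C (I t)" using assms(2) by (simp add: isCont_cdf)
      then show "(C \<longlongrightarrow> C (I t)) (at_left (I t))"
        unfolding isCont_def by (rule tendsto_within_subset) simp
      have "C x \<le> t" if "x < I t" for x
        using pseudoinverse[OF t, of x] that by auto
      then show "eventually (\<lambda>x. C x \<le> t) (at_left (I t))"
        by (auto simp: eventually_at_filter)
    qed simp
    moreover have "t \<le> C (I t)" using pseudoinverse[OF t, of "I t"] by simp
    ultimately show "C (if t \<in> {0<..<1} then I t else 0) = t" using t by simp
  qed
qed

text \<open>Transport the probability to the line along an injection with measurable left inverse;
  its distribution function is then continuous, and the quantile function inverts it.\<close>

lemma atomless_isomorphism:
  fixes M :: "(nat \<Rightarrow> real) measure"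
  assumes "prob_space M" and sets: "sets M = sets (PiM UNIV (\<lambda>_. borel))" and atomless: "\<And>x. emeasure M {x} = 0"
  obtains \<theta> and \<Phi> :: "_ \<Rightarrow> real" where "\<theta> \<in> L01 \<rightarrow>\<^sub>M M" "\<Phi> \<in> borel_measurable M" "distr L01 M \<theta> = M" "AE t in L01. \<Phi> (\<theta> t) = t"
proof -
  interpret prob_space M by fact
  note [measurable_cong] = sets
  obtain h and k :: "real \<Rightarrow> nat \<Rightarrow> real"
    where h[measurable]: "h \<in> borel_measurable (PiM UNIV (\<lambda>_. borel))"
      and k[measurable]: "k \<in> borel \<rightarrow>\<^sub>M PiM UNIV (\<lambda>_. borel)" and kh: "\<And>x. k (h x) = x"
    using real_sequences_embed_in_real by metis
  have sp: "space M = UNIV" using sets_eq_imp_space_eq[OF sets] by (simp add: space_PiM)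
  have h'[measurable]: "h \<in> borel_measurable M" by measurable
  have k'[measurable]: "k \<in> borel \<rightarrow>\<^sub>M M" by measurable
  define N where "N = distr M borel h"
  have N: "real_distribution N"
    unfolding N_def by (simp add: real_distribution_distr)
  \<comment> \<open>Singleton fibres turn an atom of \<open>N\<close> into an atom of
    \<open>M\<close>.\<close>
  have inj: "h -` {h x} = {x}" for x using kh by (auto dest: arg_cong[where f=k])
  have null: "emeasure N {y} = 0" for y
  proof (cases "y \<in> range h")
    case True
    then show ?thesis using inj atomless by (auto simp: N_def emeasure_distr sp)
  next
    case False
    then have "h -` {y} = {}" by auto
    then show ?thesis by (simp add: N_def emeasure_distr)
  qed
  then have "measure N {y} = 0" for y by (simp add: measure_def)
  with N obtain F G :: "real \<Rightarrow> real" where F[measurable]: "F \<in> borel_measurable borel" and G[measurable]: "G \<in> borel_measurable borel"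
    and GN: "\<And>A. A \<in> sets borel \<Longrightarrow> emeasure lborel (G -` A \<inter> {0<..<1}) = emeasure N A"
    and FG: "\<And>t. 0 < t \<Longrightarrow> t < 1 \<Longrightarrow> F (G t) = t"
    using quantile_transform by metis
  have L01: "emeasure L01 (A \<inter> {0..1}) = emeasure lborel (A \<inter> {0<..<1})" if "A \<in> sets borel" for A
  proof -
    have "emeasure L01 (A \<inter> {0..1}) = emeasure lborel (A \<inter> {0..1})"
      using that by (subst emeasure_restrict_space) auto
    also have "\<dots> = emeasure lborel (A \<inter> {0<..<1})"
    proof (rule emeasure_eq_AE)
      show "AE x in lborel. x \<in> A \<inter> {0..1} \<longleftrightarrow> x \<in> A \<inter> {0<..<1}"
        using AE_lborel_singleton[of 0] AE_lborel_singleton[of 1] by eventually_elim auto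
    qed (use that in auto)
    finally show ?thesis .
  qed
  let ?\<theta> = "\<lambda>t. k (G t)" and ?\<Phi> = "\<lambda>x. F (h x)"
  have \<theta>b: "?\<theta> \<in> borel \<rightarrow>\<^sub>M M" by measurable
  have lift: "f \<in> L01 \<rightarrow>\<^sub>M K" if "f \<in> borel \<rightarrow>\<^sub>M K" for f :: "real \<Rightarrow> 'z" and K
    using that by (auto intro!: measurable_restrict_space1 measurable_completion)
  have \<theta>: "?\<theta> \<in> L01 \<rightarrow>\<^sub>M M" by (rule lift[OF \<theta>b])
  show ?thesis
  proof (rule that[OF \<theta>, of ?\<Phi>])
    show "?\<Phi> \<in> borel_measurable M" by measurable
    show "distr L01 M ?\<theta> = M"
    proof (rule measure_eqI)
      fix A assume "A \<in> sets (distr L01 M ?\<theta>)"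
      then have A[measurable]: "A \<in> sets M" by simp
      have kA: "k -` A \<in> sets borel" using measurable_sets[OF k' A] by simp
      have "emeasure (distr L01 M ?\<theta>) A = emeasure L01 (?\<theta> -` A \<inter> {0..1})"
        using \<theta> by (subst emeasure_distr) auto
      also have "\<dots> = emeasure lborel (G -` (k -` A) \<inter> {0<..<1})"
        using measurable_sets[OF \<theta>b A] by (subst L01) (auto simp: vimage_comp o_def)
      also have "\<dots> = emeasure N (k -` A)" by (rule GN[OF kA])
      also have "\<dots> = emeasure M A"
        using kA kh by (simp add: N_def emeasure_distr sp vimage_comp o_def)
      finally show "emeasure (distr L01 M ?\<theta>) A = emeasure M A" .
    qed simp
    \<comment> \<open>\<open>N\<close> is carried by the range of \<open>h\<close>, where h (k t) =
      t. So \<open>G\<close> avoids \<open>?B\<close> almost everywhere, and there F (h (k (G t))) =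
      F (G t) = t.\<close>
    let ?B = "{t. h (k t) \<noteq> t}"
    have B: "?B \<in> sets borel" by measurable
    have "emeasure N ?B = 0"
      using B kh by (simp add: N_def emeasure_distr sp)
    then have "emeasure lborel (G -` ?B \<inter> {0<..<1}) = 0" using GN[OF B] by simp
    then have 1: "G -` ?B \<inter> {0<..<1} \<in> null_sets lborel"
      using measurable_sets[OF G B] by (auto simp: null_sets_def)
    have "AE t in lborel. t \<in> {0..1} \<longrightarrow> ?\<Phi> (?\<theta> t) = t"
      using AE_lborel_singleton[of 0] AE_lborel_singleton[of 1] AE_not_in[OF 1]
      by eventually_elim (auto simp: FG)
    then have "AE t in lebesgue. t \<in> {0..1} \<longrightarrow> ?\<Phi> (?\<theta> t) = t"
      by (rule AE_completion)
    then show "AE t in L01. ?\<Phi> (?\<theta> t) = t"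
      by (subst AE_restrict_space_iff) auto
  qed
qed

section \<open>The isometry\<close>

text \<open>The p-th power of the norm with values in \<open>ennreal\<close>: membership in L^p
  becomes finiteness, and sums over pieces carry no integrability conditions.\<close>

definition Lp_energy :: "real \<Rightarrow> 'a measure \<Rightarrow> ('a \<Rightarrow> real) \<Rightarrow> ennreal" where
  "Lp_energy p M f = (\<integral>\<^sup>+x. ennreal (\<bar>f x\<bar> powr p) \<partial>M)"

lemma Lp_set_iff: "f \<in> Lp_set p M \<longleftrightarrow> f \<in> borel_measurable M \<and> Lp_energy p M f < \<infinity>"
  by (auto simp: Lp_set_def Lp_energy_def integrable_iff_bounded)

lemma Lp_norm_eq: "f \<in> borel_measurable M \<Longrightarrow> Lp_norm p M f = enn2real (Lp_energy p M f) powr (1 / p)"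
  unfolding Lp_norm_def Lp_energy_def by (subst integral_eq_nn_integral) auto

lemma Lp_norm_powr:
  "f \<in> borel_measurable M \<Longrightarrow> 0 < p \<Longrightarrow> Lp_norm p M f powr p = enn2real (Lp_energy p M f)"
  by (simp add: Lp_norm_eq powr_powr)

lemma Lp_energy_cong_AE:
  "(AE x in M. f x = g x) \<Longrightarrow> Lp_energy p M f = Lp_energy p M g"
  unfolding Lp_energy_def by (rule nn_integral_cong_AE) auto

lemma nn_integral_count_space_summable:
  fixes r :: "'a \<Rightarrow> real"
  assumes "\<And>j. 0 \<le> r j" "(\<integral>\<^sup>+j. ennreal (r j) \<partial>count_space UNIV) < \<infinity>"
  shows "r summable_on UNIV" "infsum r UNIV = enn2real (\<integral>\<^sup>+j. ennreal (r j) \<partial>count_space UNIV)"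
proof -
  have "integrable (count_space UNIV) r"
    using assms by (intro integrableI_bounded) auto
  then have r: "Infinite_Set_Sum.abs_summable_on r UNIV"
    by (simp add: Infinite_Set_Sum.abs_summable_on_def)
  then show "r summable_on UNIV"
    using abs_summable_equivalent[of r UNIV] assms(1) by simp
  show "infsum r UNIV = enn2real (\<integral>\<^sup>+j. ennreal (r j) \<partial>count_space UNIV)"
    using infsetsum_infsum[OF r] infsetsum_conv_nn_integral[of UNIV r] assms by simp
qed

lemma nn_integral_count_space_infsum:
  fixes r :: "'a \<Rightarrow> real"
  assumes "\<And>j. 0 \<le> r j" "r summable_on UNIV"
  shows "(\<integral>\<^sup>+j. ennreal (r j) \<partial>count_space UNIV) = ennreal (infsum r UNIV)"
proof -
  have r: "Infinite_Set_Sum.abs_summable_on r UNIV"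
    using abs_summable_equivalent[of r UNIV] assms by simp
  then show ?thesis
    using nn_integral_conv_infsetsum[OF r] infsetsum_infsum[OF r] assms(1) by simp
qed

text \<open>The family may be uncountable, but pieces outside \<open>J\<close> are disjoint from the
  support up to null sets and contribute 0. On \<open>J\<close> this is countable additivity of the
  density measure.\<close>

lemma nn_integral_disjoint_pieces:
  assumes E[measurable]: "\<And>j. E j \<in> sets M" and disj: "disjoint_family E"
    and J: "countable J" and u[measurable]: "u \<in> borel_measurable M"
    and supp: "AE x in M. u x \<noteq> 0 \<longrightarrow> x \<in> (\<Union>j\<in>J. E j)"
  shows "(\<integral>\<^sup>+x. u x \<partial>M) = (\<integral>\<^sup>+j. (\<integral>\<^sup>+x. u x * indicator (E j) x \<partial>M) \<partial>count_space UNIV)"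
proof -
  let ?D = "density M u"
  have zero: "(\<integral>\<^sup>+x. u x * indicator (E j) x \<partial>M) = 0" if "j \<notin> J" for j
  proof -
    have "AE x in M. u x * indicator (E j) x = 0"
      using supp
    proof eventually_elim
      case (elim x)
      have "x \<notin> E j" if "x \<in> (\<Union>j\<in>J. E j)"
      proof -
        from that obtain i where "i \<in> J" "x \<in> E i" by auto
        moreover from this \<open>j \<notin> J\<close> have "E i \<inter> E j = {}"
          by (intro disjoint_family_onD[OF disj]) auto
        ultimately show ?thesis by auto
      qed
      with elim show ?case by (auto simp: indicator_def)
    qed
    then show ?thesis by (subst nn_integral_0_iff_AE) auto
  qed
  have [measurable]: "(\<Union>j\<in>J. E j) \<in> sets M" using J by (intro sets.countable_UN') auto
  have "(\<integral>\<^sup>+x. u x \<partial>M) = (\<integral>\<^sup>+x. u x * indicator (\<Union>j\<in>J. E j) x \<partial>M)"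
    using supp by (intro nn_integral_cong_AE) (auto simp: indicator_def)
  also have "\<dots> = emeasure ?D (\<Union>j\<in>J. E j)"
    by (rule emeasure_density[symmetric]) auto
  also have "\<dots> = (\<integral>\<^sup>+j. emeasure ?D (E j) \<partial>count_space J)"
    using J disj by (intro emeasure_UN_countable) (auto simp: disjoint_family_on_def)
  also have "\<dots> = (\<integral>\<^sup>+j. (\<integral>\<^sup>+x. u x * indicator (E j) x \<partial>M) \<partial>count_space J)"
    by (intro nn_integral_cong emeasure_density) auto
  also have "\<dots> = (\<integral>\<^sup>+j. (\<integral>\<^sup>+x. u x * indicator (E j) x \<partial>M) * indicator J j \<partial>count_space UNIV)"
    by (rule nn_integral_count_space_indicator) auto
  also have "\<dots> = (\<integral>\<^sup>+j. (\<integral>\<^sup>+x. u x * indicator (E j) x \<partial>M) \<partial>count_space UNIV)"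
    using zero by (intro nn_integral_cong) (auto simp: indicator_def)
  finally show ?thesis .
qed

text \<open>By Markov's inequality the sets where u is at least 1/(n+1) have finite measure, and
  they exhaust the support. This replaces sigma-finiteness.\<close>

lemma finite_nn_integral_support_cover:
  assumes E[measurable]: "\<And>j. E j \<in> sets M"
    and cover: "\<And>A. A \<in> sets M \<Longrightarrow> emeasure M A < \<infinity> \<Longrightarrow> \<exists>J. countable J \<and> A - (\<Union>a\<in>J. E a) \<in> null_sets M"
    and u[measurable]: "u \<in> borel_measurable M" and fin: "(\<integral>\<^sup>+x. u x \<partial>M) < \<infinity>"
  shows "\<exists>J. countable J \<and> (AE x in M. u x \<noteq> 0 \<longrightarrow> x \<in> (\<Union>j\<in>J. E j))"
proof -
  let ?A = "\<lambda>n. {x\<in>space M. 1 \<le> of_nat (Suc n) * u x}"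
  have "\<exists>J. countable J \<and> ?A n - (\<Union>a\<in>J. E a) \<in> null_sets M" for n
  proof (rule cover)
    show "?A n \<in> sets M" by measurable
    have "emeasure M (?A n) \<le> of_nat (Suc n) * (\<integral>\<^sup>+x. u x * indicator (space M) x \<partial>M)"
      by (rule nn_integral_Markov_inequality) auto
    also have "(\<integral>\<^sup>+x. u x * indicator (space M) x \<partial>M) = (\<integral>\<^sup>+x. u x \<partial>M)"
      by (intro nn_integral_cong) auto
    also have "of_nat (Suc n) * \<dots> < \<infinity>"
      using fin by (simp add: ennreal_mult_less_top of_nat_less_top del: of_nat_Suc)
    finally show "emeasure M (?A n) < \<infinity>" .
  qed
  then have "\<forall>n. \<exists>J. countable J \<and> ?A n - (\<Union>a\<in>J. E a) \<in> null_sets M" ..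
  then obtain J where J: "\<forall>n. countable (J n) \<and> ?A n - (\<Union>a\<in>J n. E a) \<in> null_sets M"
    by (rule choice[THEN exE])
  show ?thesis
  proof (intro exI conjI)
    show "countable (\<Union>n. J n)" using J by auto
    have "AE x in M. \<forall>n. x \<notin> ?A n - (\<Union>a\<in>J n. E a)"
      unfolding AE_all_countable by (intro allI AE_not_in) (rule conjunct2[OF spec[OF J]])
    with AE_space show "AE x in M. u x \<noteq> 0 \<longrightarrow> x \<in> (\<Union>j\<in>(\<Union>n. J n). E j)"
    proof (eventually_elim, intro impI)
      fix x assume x: "x \<in> space M" "\<forall>n. x \<notin> ?A n - (\<Union>a\<in>J n. E a)" "u x \<noteq> 0"
      have "\<exists>n. 1 \<le> of_nat (Suc n) * u x"
      proof (cases "u x")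
        case (real v)
        with x(3) have "0 < v" by (cases "v = 0") auto
        then obtain n where "1 / Suc n < v" using nat_approx_posE by metis
        then have "1 \<le> real (Suc n) * v" by (simp add: field_simps)
        then have "ennreal 1 \<le> ennreal (real (Suc n) * v)" by (rule ennreal_leI)
        then show ?thesis using real by (intro exI[of _ n]) (simp add: ennreal_mult ennreal_of_nat_eq_real_of_nat del: of_nat_Suc)
      next
        case top
        then show ?thesis by (intro exI[of _ 0]) simp
      qed
      then obtain n where "1 \<le> of_nat (Suc n) * u x" ..
      with x(1) spec[OF x(2), of n] have "x \<in> (\<Union>a\<in>J n. E a)" by blast
      then show "x \<in> (\<Union>j\<in>(\<Union>n. J n). E j)" by auto
    qed
  qed
qed

text \<open>Composing with a measurable \<open>\<Phi> j\<close> preserves measurability for Borel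
  functions, while elements of L^p over \<open>L01\<close> are only Lebesgue measurable.\<close>

lemma L01_borel_version:
  assumes "g \<in> borel_measurable L01"
  obtains g' :: "real \<Rightarrow> real" where "g' \<in> borel_measurable borel" "AE t in L01. g t = g' t"
proof -
  have "(\<lambda>t. if t \<in> {0..1} then g t else 0) \<in> borel_measurable lebesgue"
    using assms by (subst (asm) borel_measurable_if[symmetric]) auto
  then obtain g' where g': "g' \<in> borel_measurable lborel" "AE t in lborel. (if t \<in> {0..1} then g t else 0) = g' t"
    using completion_ex_borel_measurable_real by blast
  have "AE t in lebesgue. (if t \<in> {0..1} then g t else 0) = g' t"
    using g'(2) by (rule AE_completion)
  then have "AE t in L01. g t = g' t"
    by (subst AE_restrict_space_iff) (auto elim!: eventually_mono split: if_splits)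
  with g'(1) that show ?thesis by simp
qed

text \<open>Isometry comes from \<open>distr\<close>, the covering property and countable supports;
  surjectivity comes from \<open>inv\<close>, through which each component of a family is pulled
  back to its piece.\<close>

lemma Lp_isometric_to_ellp:
  fixes M :: "'a measure" and E :: "real \<Rightarrow> 'a set" and \<theta> :: "real \<Rightarrow> real \<Rightarrow> 'a" and \<Phi> :: "real \<Rightarrow> 'a \<Rightarrow> real"
  assumes p: "1 \<le> p"
    and E[measurable]: "\<And>j. E j \<in> sets M"
    and fin: "\<And>j. emeasure M (E j) < \<infinity>" and pos: "\<And>j. emeasure M (E j) \<noteq> 0"
    and disj: "disjoint_family E"
    and cover: "\<And>A. A \<in> sets M \<Longrightarrow> emeasure M A < \<infinity> \<Longrightarrow> \<exists>J. countable J \<and> A - (\<Union>a\<in>J. E a) \<in> null_sets M"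
    and \<theta>[measurable]: "\<And>j. \<theta> j \<in> L01 \<rightarrow>\<^sub>M M" and \<Phi>[measurable]: "\<And>j. \<Phi> j \<in> borel_measurable M"
    and distr: "\<And>j. distr L01 M (\<theta> j) = uniform_measure M (E j)"
    and inv: "\<And>j. AE t in L01. \<Phi> j (\<theta> j t) = t"
  shows "\<exists>T :: ('a \<Rightarrow> real) \<Rightarrow> (real \<Rightarrow> real \<Rightarrow> real).
    (\<forall>f \<in> Lp_set p M. T f \<in> ellp_Lp01 p) \<and>
    (\<forall>f \<in> Lp_set p M. \<forall>g \<in> Lp_set p M. \<forall>a b :: real.
        ellp_norm p (\<lambda>j t. T (\<lambda>x. a * f x + b * g x) j t - (a * T f j t + b * T g j t)) = 0) \<and>
    (\<forall>f \<in> Lp_set p M. ellp_norm p (T f) = Lp_norm p M f) \<and>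
    (\<forall>y \<in> ellp_Lp01 p. \<exists>f \<in> Lp_set p M. ellp_norm p (\<lambda>j t. T f j t - y j t) = 0)"
proof -
  have p0: "0 < p" using p by simp
  define c where "c j = measure M (E j)" for j
  have c: "emeasure M (E j) = ennreal (c j)" for j
    using fin[of j] by (simp add: c_def emeasure_eq_ennreal_measure less_top)
  have c_pos: "0 < c j" for j
    using pos[of j] c[of j] by (auto simp: ennreal_eq_0_iff not_le)
  \<comment> \<open>The factor undoes the normalisation of \<open>uniform_measure\<close>: its p-th
    power is \<open>c j\<close>.\<close>
  define T where "T f j t = c j powr (1 / p) * f (\<theta> j t)" for f j t
  have T_meas: "T f j \<in> borel_measurable L01" if [measurable]: "f \<in> borel_measurable M" for f j
    unfolding T_def by measurable
  have energy_T: "Lp_energy p L01 (T f j) = (\<integral>\<^sup>+x. ennreal (\<bar>f x\<bar> powr p) * indicator (E j) x \<partial>M)"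
    if f[measurable]: "f \<in> borel_measurable M" for f j
  proof -
    have "Lp_energy p L01 (T f j) = (\<integral>\<^sup>+t. ennreal (c j) * ennreal (\<bar>f (\<theta> j t)\<bar> powr p) \<partial>L01)"
      unfolding Lp_energy_def T_def using p0 c_pos[of j]
      by (intro nn_integral_cong) (simp add: abs_mult powr_mult powr_powr ennreal_mult)
    also have "\<dots> = ennreal (c j) * (\<integral>\<^sup>+t. ennreal (\<bar>f (\<theta> j t)\<bar> powr p) \<partial>L01)"
      by (rule nn_integral_cmult) measurable
    also have "(\<integral>\<^sup>+t. ennreal (\<bar>f (\<theta> j t)\<bar> powr p) \<partial>L01) = (\<integral>\<^sup>+x. ennreal (\<bar>f x\<bar> powr p) \<partial>distr L01 M (\<theta> j))"
      by (rule nn_integral_distr[symmetric]) measurable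
    also have "\<dots> = (\<integral>\<^sup>+x. ennreal (\<bar>f x\<bar> powr p) * indicator (E j) x \<partial>M) / ennreal (c j)"
      unfolding distr by (subst nn_integral_uniform_measure) (auto simp: c)
    also have "ennreal (c j) * \<dots> = (\<integral>\<^sup>+x. ennreal (\<bar>f x\<bar> powr p) * indicator (E j) x \<partial>M)"
      using c_pos[of j] by (simp add: ennreal_times_divide mult_divide_eq_ennreal mult.commute[of "ennreal (c j)"])
    finally show ?thesis .
  qed
  have energy_sum: "Lp_energy p M f = (\<integral>\<^sup>+j. Lp_energy p L01 (T f j) \<partial>count_space UNIV)"
    if f[measurable]: "f \<in> borel_measurable M" and J: "countable J" "AE x in M. f x \<noteq> 0 \<longrightarrow> x \<in> (\<Union>j\<in>J. E j)" for f J
  proof -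
    have "AE x in M. ennreal (\<bar>f x\<bar> powr p) \<noteq> 0 \<longrightarrow> x \<in> (\<Union>j\<in>J. E j)"
      using J(2) by eventually_elim auto
    then show ?thesis
      unfolding energy_T[OF f] unfolding Lp_energy_def
      using E disj J(1) by (intro nn_integral_disjoint_pieces) auto
  qed
  have energy_Lp: "Lp_energy p M f = (\<integral>\<^sup>+j. Lp_energy p L01 (T f j) \<partial>count_space UNIV)"
    and energy_T_fin: "Lp_energy p L01 (T f j) < \<infinity>" if f: "f \<in> Lp_set p M" for f j
  proof -
    have f'[measurable]: "f \<in> borel_measurable M" and "Lp_energy p M f < \<infinity>" using f by (auto simp: Lp_set_iff)
    then have "(\<integral>\<^sup>+x. ennreal (\<bar>f x\<bar> powr p) \<partial>M) < \<infinity>" by (simp add: Lp_energy_def)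
    moreover have "(\<lambda>x. ennreal (\<bar>f x\<bar> powr p)) \<in> borel_measurable M" by measurable
    ultimately obtain J where J: "countable J" "AE x in M. ennreal (\<bar>f x\<bar> powr p) \<noteq> 0 \<longrightarrow> x \<in> (\<Union>j\<in>J. E j)"
      using finite_nn_integral_support_cover[of E M "\<lambda>x. ennreal (\<bar>f x\<bar> powr p)", OF E cover] by auto
    then have "AE x in M. f x \<noteq> 0 \<longrightarrow> x \<in> (\<Union>j\<in>J. E j)"
      by (auto elim!: eventually_mono)
    with f' J(1) show "Lp_energy p M f = (\<integral>\<^sup>+j. Lp_energy p L01 (T f j) \<partial>count_space UNIV)"
      by (rule energy_sum)
    have "Lp_energy p L01 (T f j) \<le> Lp_energy p M f"
      unfolding energy_T[OF f'] unfolding Lp_energy_def by (intro nn_integral_mono) (auto simp: indicator_def)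
    also have "\<dots> < \<infinity>" by fact
    finally show "Lp_energy p L01 (T f j) < \<infinity>" .
  qed
  have T_ellp: "T f \<in> ellp_Lp01 p" and T_norm: "ellp_norm p (T f) = Lp_norm p M f" if f: "f \<in> Lp_set p M" for f
  proof -
    have f': "f \<in> borel_measurable M" and f_fin: "Lp_energy p M f < \<infinity>" using f by (auto simp: Lp_set_iff)
    have r: "Lp_norm p L01 (T f j) powr p = enn2real (Lp_energy p L01 (T f j))" for j
      by (rule Lp_norm_powr[OF T_meas[OF f'] p0])
    have "ennreal (enn2real (Lp_energy p L01 (T f j))) = Lp_energy p L01 (T f j)" for j
      using energy_T_fin[OF f] by simp
    then have total: "(\<integral>\<^sup>+j. ennreal (Lp_norm p L01 (T f j) powr p) \<partial>count_space UNIV) = Lp_energy p M f"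
      using energy_Lp[OF f] by (simp add: r)
    have "(\<lambda>j. Lp_norm p L01 (T f j) powr p) summable_on UNIV"
      and "(\<Sum>\<^sub>\<infinity>j. Lp_norm p L01 (T f j) powr p) = enn2real (Lp_energy p M f)"
      using nn_integral_count_space_summable[of "\<lambda>j. Lp_norm p L01 (T f j) powr p"] f_fin total by auto
    then show "T f \<in> ellp_Lp01 p" "ellp_norm p (T f) = Lp_norm p M f"
      using f' T_meas energy_T_fin[OF f] by (auto simp: ellp_Lp01_def ellp_norm_def Lp_set_iff Lp_norm_eq)
  qed
  have ellp_norm_zero: "ellp_norm p h = 0" if "\<And>j. AE t in L01. h j t = 0" for h
  proof -
    have "Lp_norm p L01 (h j) = 0" for j
    proof -
      have "(\<integral>t. \<bar>h j t\<bar> powr p \<partial>L01) = 0"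
        using that[of j] by (intro integral_eq_zero_AE) (auto elim!: eventually_mono)
      then show ?thesis by (simp add: Lp_norm_def)
    qed
    then show ?thesis by (simp add: ellp_norm_def)
  qed
  have onto: "\<exists>f \<in> Lp_set p M. ellp_norm p (\<lambda>j t. T f j t - y j t) = 0" if y: "y \<in> ellp_Lp01 p" for y
  proof -
    define r where "r j = Lp_norm p L01 (y j) powr p" for j
    have y_meas: "y j \<in> borel_measurable L01" and y_fin: "Lp_energy p L01 (y j) < \<infinity>" for j
      using y by (auto simp: ellp_Lp01_def Lp_set_iff)
    have r: "ennreal (r j) = Lp_energy p L01 (y j)" for j
      using y_fin[of j] by (simp add: r_def Lp_norm_powr[OF y_meas p0])
    have r_sum: "r summable_on UNIV" using y by (simp add: ellp_Lp01_def r_def[abs_def])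
    \<comment> \<open>A summable family has countable support, so a preimage can be glued measurably
      from countably many pieces.\<close>
    define J where "J = {j. r j \<noteq> 0}"
    have J: "countable J" using summable_countable_real[OF r_sum] by (simp add: J_def)
    have "\<forall>j. \<exists>g \<in> borel_measurable borel. AE t in L01. y j t = g t"
      using L01_borel_version[OF y_meas] by metis
    then obtain g where g[measurable]: "\<And>j. g j \<in> borel_measurable borel" and yg: "\<And>j. AE t in L01. y j t = g j t"
      by metis
    define \<iota> where "\<iota> x = (THE j. x \<in> E j)" for x
    have \<iota>: "\<iota> x = j" if "x \<in> E j" for x j
      unfolding \<iota>_def
    proof (rule the_equality[where P="\<lambda>j. x \<in> E j"])
      fix i assume "x \<in> E i"
      with that show "i = j" using disjoint_family_onD[OF disj, of i j] by auto
    qed fact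
    \<comment> \<open>On \<open>E j\<close> this undoes \<open>T\<close>: divide out the scaling and
      substitute \<open>\<Phi> j\<close> for the interval variable.\<close>
    define f where "f x = (if x \<in> (\<Union>j\<in>J. E j) then c (\<iota> x) powr (- 1 / p) * g (\<iota> x) (\<Phi> (\<iota> x) x) else 0)" for x
    have f_E: "f x = c j powr (- 1 / p) * g j (\<Phi> j x)" if "x \<in> E j" "j \<in> J" for x j
      using that \<iota>[OF that(1)] by (auto simp: f_def)
    have f_out: "f x = 0" if "x \<in> E j" "j \<notin> J" for x j
    proof -
      have "x \<notin> (\<Union>j\<in>J. E j)" using that \<iota> by auto
      then show ?thesis by (simp add: f_def)
    qed
    have UJ: "(\<Union>j\<in>J. E j) \<in> sets M" using J by (intro sets.countable_UN') auto
    have f_meas: "f \<in> borel_measurable M"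
    proof (rule measurable_piecewise_restrict[of "insert (space M - (\<Union>j\<in>J. E j)) (E ` J)"])
      show "countable (insert (space M - (\<Union>j\<in>J. E j)) (E ` J))" using J by auto
      show "\<Omega> \<inter> space M \<in> sets M" if "\<Omega> \<in> insert (space M - (\<Union>j\<in>J. E j)) (E ` J)" for \<Omega>
        using that UJ E by auto
      show "space M \<subseteq> \<Union>(insert (space M - (\<Union>j\<in>J. E j)) (E ` J))" by auto
      fix \<Omega> assume "\<Omega> \<in> insert (space M - (\<Union>j\<in>J. E j)) (E ` J)"
      then consider "\<Omega> = space M - (\<Union>j\<in>J. E j)" | j where "j \<in> J" "\<Omega> = E j" by auto
      then show "f \<in> borel_measurable (restrict_space M \<Omega>)"
      proof cases
        case 1
        then have "f x = 0" if "x \<in> space (restrict_space M \<Omega>)" for x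
          using that by (auto simp: space_restrict_space f_def)
        then show ?thesis by (subst measurable_cong[where g="\<lambda>_. 0"]) auto
      next
        case 2
        have m: "(\<lambda>x. c j powr (- 1 / p) * g j (\<Phi> j x)) \<in> borel_measurable (restrict_space M \<Omega>)"
          by (rule measurable_restrict_space1) measurable
        have "f x = c j powr (- 1 / p) * g j (\<Phi> j x)" if "x \<in> space (restrict_space M \<Omega>)" for x
          using that 2 f_E by (auto simp: space_restrict_space)
        with m show ?thesis by (rule measurable_cong[THEN iffD2, rotated])
      qed
    qed
    have in_E: "AE t in L01. \<theta> j t \<in> E j" for j
    proof -
      have "AE x in uniform_measure M (E j). x \<in> E j"
        by (intro AE_uniform_measureI) auto
      then have "AE x in distr L01 M (\<theta> j). x \<in> E j" by (simp only: distr)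
      then show ?thesis by (rule AE_distrD[OF \<theta>])
    qed
    have Tf: "AE t in L01. T f j t = y j t" for j
    proof (cases "j \<in> J")
      case True
      have cc: "c j powr (1 / p) * c j powr (- 1 / p) = 1"
        using c_pos[of j] by (simp add: powr_add[symmetric])
      show ?thesis
        using in_E[of j] inv[of j] yg[of j]
      proof eventually_elim
        case (elim t)
        then have "T f j t = (c j powr (1 / p) * c j powr (- 1 / p)) * g j t"
          using True by (simp add: T_def f_E)
        with cc elim show ?case by simp
      qed
    next
      case False
      \<comment> \<open>Outside \<open>J\<close> the component \<open>y j\<close> vanishes almost
        everywhere, in agreement with f = 0 on \<open>E j\<close>.\<close>
      then have "Lp_energy p L01 (y j) = 0" using r[of j] by (simp add: J_def)
      then have "AE t in L01. ennreal (\<bar>y j t\<bar> powr p) = 0"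
        using y_meas[of j] unfolding Lp_energy_def by (subst (asm) nn_integral_0_iff_AE) auto
      with in_E[of j] show ?thesis
        by eventually_elim (use False in \<open>auto simp: T_def f_out\<close>)
    qed
    have "Lp_energy p M f = (\<integral>\<^sup>+j. Lp_energy p L01 (T f j) \<partial>count_space UNIV)"
      using f_meas J by (rule energy_sum) (auto simp: f_def)
    also have "\<dots> = (\<integral>\<^sup>+j. ennreal (r j) \<partial>count_space UNIV)"
      using Lp_energy_cong_AE[OF Tf] by (simp add: r)
    also have "\<dots> = ennreal (infsum r UNIV)"
      by (rule nn_integral_count_space_infsum[OF _ r_sum]) (simp add: r_def)
    also have "\<dots> < \<infinity>" by simp
    finally have "f \<in> Lp_set p M" using f_meas by (simp add: Lp_set_iff)
    moreover have "ellp_norm p (\<lambda>j t. T f j t - y j t) = 0"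
      using Tf by (intro ellp_norm_zero) auto
    ultimately show ?thesis by blast
  qed
  have "ellp_norm p (\<lambda>j t. T (\<lambda>x. a * f x + b * g x) j t - (a * T f j t + b * T g j t)) = 0" for a b f g
    by (rule ellp_norm_zero) (simp add: T_def algebra_simps)
  with T_ellp T_norm onto show ?thesis by (intro exI[of _ T]) blast
qed

text \<open>Both spaces consist of representatives with seminorms, so linearity and surjectivity
  hold up to seminorm 0. Together with norm preservation this makes \<open>T\<close> well defined
  and injective on classes.\<close>

theorem theorem1p1:
  fixes p :: real
  assumes "1 \<le> p" and "CH"
  shows "\<exists>T :: ((nat \<Rightarrow> real) \<Rightarrow> real) \<Rightarrow> (real \<Rightarrow> real \<Rightarrow> real).
    (\<forall>f \<in> Lp_set p mu. T f \<in> ellp_Lp01 p) \<and>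
    (\<forall>f \<in> Lp_set p mu. \<forall>g \<in> Lp_set p mu. \<forall>a b :: real.
        ellp_norm p (\<lambda>j t. T (\<lambda>x. a * f x + b * g x) j t - (a * T f j t + b * T g j t)) = 0) \<and>
    (\<forall>f \<in> Lp_set p mu. ellp_norm p (T f) = Lp_norm p mu f) \<and>
    (\<forall>y \<in> ellp_Lp01 p. \<exists>f \<in> Lp_set p mu. ellp_norm p (\<lambda>j t. T f j t - y j t) = 0)"
proof -
  obtain E :: "real \<Rightarrow> (nat \<Rightarrow> real) set"
    where E: "\<And>a. E a \<in> sets mu" "\<And>a. emeasure mu (E a) < \<infinity>" "\<And>a. emeasure mu (E a) \<noteq> 0" "disjoint_family E"
      and cover: "\<And>A. A \<in> sets mu \<Longrightarrow> emeasure mu A < \<infinity> \<Longrightarrow> \<exists>J. countable J \<and> A - (\<Union>a\<in>J. E a) \<in> null_sets mu"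
    using mu_positive_decomposition[OF assms(2)] by blast
  have "\<exists>\<theta> \<Phi>. \<theta> \<in> L01 \<rightarrow>\<^sub>M mu \<and> \<Phi> \<in> borel_measurable mu \<and> distr L01 mu \<theta> = uniform_measure mu (E j) \<and>
      (AE t in L01. \<Phi> (\<theta> t) = t)" for j
  proof -
    let ?M = "uniform_measure mu (E j)"
    have "prob_space ?M"
      using E(2)[of j] E(3)[of j] by (intro prob_space_uniform_measure) auto
    moreover have "sets ?M = sets (PiM UNIV (\<lambda>_. borel))" by (simp add: sets_mu)
    moreover have "emeasure ?M {x} = 0" for x
    proof -
      have "{x} = rect (\<lambda>i. {x i})" by (auto simp: rect_def)
      then have x: "{x} \<in> sets mu" by (simp add: rect_in_sets_mu)
      have "emeasure mu (E j \<inter> {x}) \<le> emeasure mu {x}" using x by (intro emeasure_mono) auto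
      then have "emeasure mu (E j \<inter> {x}) = 0" by (simp add: emeasure_mu_singleton)
      then show ?thesis using E(1) x by (simp add: emeasure_uniform_measure)
    qed
    ultimately obtain \<theta> and \<Phi> :: "(nat \<Rightarrow> real) \<Rightarrow> real"
      where \<theta>: "\<theta> \<in> L01 \<rightarrow>\<^sub>M ?M" "\<Phi> \<in> borel_measurable ?M" "distr L01 ?M \<theta> = ?M" "AE t in L01. \<Phi> (\<theta> t) = t"
      by (rule atomless_isomorphism) blast
    \<comment> \<open>\<open>uniform_measure\<close> keeps the measurable sets of \<open>mu\<close>,
      so the maps can be regarded as maps into or from \<open>mu\<close>.\<close>
    have "\<theta> \<in> L01 \<rightarrow>\<^sub>M mu" "\<Phi> \<in> borel_measurable mu"
      using \<theta>(1,2) by (simp_all cong: measurable_cong_sets)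
    moreover have "distr L01 mu \<theta> = ?M"
      using \<theta>(3) by (simp cong: distr_cong)
    ultimately show ?thesis using \<theta>(4) by blast
  qed
  then have "\<forall>j. \<exists>\<theta> \<Phi>. \<theta> \<in> L01 \<rightarrow>\<^sub>M mu \<and> \<Phi> \<in> borel_measurable mu \<and>
      distr L01 mu \<theta> = uniform_measure mu (E j) \<and> (AE t in L01. \<Phi> (\<theta> t) = t)" ..
  then obtain \<theta> \<Phi> where iso: "\<forall>j. \<theta> j \<in> L01 \<rightarrow>\<^sub>M mu \<and> \<Phi> j \<in> borel_measurable mu \<and>
      distr L01 mu (\<theta> j) = uniform_measure mu (E j) \<and> (AE t in L01. \<Phi> j (\<theta> j t) = t)"
    unfolding choice_iff by (elim exE)
  show ?thesis
  proof (rule Lp_isometric_to_ellp[where E=E and \<theta>=\<theta> and \<Phi>=\<Phi>])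
    show "1 \<le> p" by fact
    show "\<exists>J. countable J \<and> A - (\<Union>a\<in>J. E a) \<in> null_sets mu" if "A \<in> sets mu" "emeasure mu A < \<infinity>" for A
      using cover that by simp
  qed (use E iso in simp_all)
qed

end
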